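(* (1) For $k\ge1$, $\lambda\in\mathcal S_k$, $\mu\in\mathcal S_{k-1}$ and $a>0$, $$\sum_{l=1}^k(1-q^{\lambda_{l-1}-\lambda_l})P_{(\lambda+1_l)/\mu}(a)=a\,P_{\lambda/\mu}(a)+\sum_{l=1}^{k-1}(1-q^{\mu_{l-1}-\mu_l+1})P_{\lambda/(\mu-1_l)}(a),$$ with the conventions $\lambda_0=\mu_0=+\infty$. (2) For $\lambda\in\mathcal S_k$, $\alpha\in[0,1)^k$ and $t>0$, $$\frac{\partial}{\partial t}Q_\lambda(\alpha,t)=\sum_{l=1}^k(1-q^{\lambda_{l-1}-\lambda_l+1})Q_{\lambda-1_l}(\alpha,t),$$ with $\lambda_0=+\infty$.
   Context: Fix $0<q<1$; $(x;q)_\infty=\prod_{k\ge0}(1-xq^k)$, $(x;q)_n=(x;q)_\infty/(xq^n;q)_\infty$ ($1/(q;q)_n=0$ for $n<0$). $\mathcal S_n=\{\lambda\in\mathbb Z^n:\lambda_1\ge\dots\ge\lambda_n\}$. $1_l$ denotes the $l$-th unit vector, so $\lambda\pm1_l$ changes $\lambda_l$ by $\pm1$. For integer tuples $\lambda\in\mathbb Z^n$, $\mu\in\mathbb Z^{n-1}$, $P_{\lambda/\mu}(a)=a^{\sum_i\lambda_i-\sum_i\mu_i}\prod_{i=1}^{n-1}\frac{(q;q)_{\lambda_i-\lambda_{i+1}}}{(q;q)_{\lambda_i-\mu_i}(q;q)_{\mu_i-\lambda_{i+1}}}$ (with $P_{\lambda/\varnothing}(a)=a^{\lambda_1}$). $P_\lambda(x_1,\dots,x_N)=\sum\prod_jP_{\lambda^{(j)}/\lambda^{(j-1)}}(x_j)$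 over $(\lambda^{(1)},\dots,\lambda^{(N)})$, $\lambda^{(n)}\in\mathcal S_n$, interlacing $\lambda^{(m+1)}_{\ell+1}\le\lambda^{(m)}_\ell\le\lambda^{(m+1)}_\ell$, $\lambda^{(N)}=\lambda$. $m_N^q(z)=\frac{1}{(2\pi i)^NN!}\prod_{i<j}(z_i/z_j;q)_\infty(z_j/z_i;q)_\infty$, $\Pi(z;\alpha,t)=\prod_{i,j}(\alpha_i/z_j;q)_\infty^{-1}\prod_je^{z_jt}$, $Q_\lambda(\alpha,t)=\prod_{i=1}^{N-1}(q^{\lambda_i-\lambda_{i+1}+1};q)_\infty\int_{\mathbb T^N}\prod_i\frac{dz_i}{z_i}P_\lambda(1/z)\Pi(z;\alpha,t)m_N^q(z)$ ($\mathbb T$ unit circle) for $\lambda\in\mathcal S_N$, and $Q_\nu:=0$ if $\nu$ is not a signature. *)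

theory Defs
  imports "HOL-Analysis.Analysis"
begin

definition qpinf :: "real \<Rightarrow> 'a::{real_normed_field,banach} \<Rightarrow> 'a" where
  "qpinf q x = prodinf (\<lambda>k. 1 - x * of_real q ^ k)"

definition qpoch :: "real \<Rightarrow> real \<Rightarrow> int \<Rightarrow> real" where
  "qpoch q x n = qpinf q x / qpinf q (x * q powi n)"

definition qqinv :: "real \<Rightarrow> int \<Rightarrow> real" where
  "qqinv q n = (if n < 0 then 0 else 1 / qpoch q q n)"

text \<open>Signatures: an integer tuple lambda_1 \<ge> ... \<ge> lambda_n, stored as a list
  (lambda_i = lam ! (i-1)).\<close>
definition is_sig :: "int list \<Rightarrow> bool" where
  "is_sig lam = sorted_wrt (\<lambda>x y. x \<ge> y) lam"

text \<open>Skew function P_{lambda/mu}(a), for lambda of length n and mu of length n-1.\<close>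
definition Pskew :: "real \<Rightarrow> int list \<Rightarrow> int list \<Rightarrow> 'a::{real_normed_field,banach} \<Rightarrow> 'a" where
  "Pskew q lam mu a = a powi (sum_list lam - sum_list mu) *
     of_real (\<Prod>i<length lam - 1.
        qpoch q q (lam!i - lam!(i+1)) * qqinv q (lam!i - mu!i) * qqinv q (mu!i - lam!(i+1)))"

definition interlace :: "int list \<Rightarrow> int list \<Rightarrow> bool" where
  "interlace mu lam = (length lam = length mu + 1 \<and>
     (\<forall>l<length mu. lam!(l+1) \<le> mu!l \<and> mu!l \<le> lam!l))"

text \<open>Gelfand-Tsetlin patterns (lambda^(1),...,lambda^(N)) with lambda^(N) = lam;
  T ! j stands for lambda^(j+1).\<close>
definition GT :: "nat \<Rightarrow> int list \<Rightarrow> int list list set" where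
  "GT N lam = {T. length T = N \<and>
     (\<forall>j<N. length (T!j) = j+1 \<and> is_sig (T!j)) \<and>
     (\<forall>j. j+1 < N \<longrightarrow> interlace (T!j) (T!(j+1))) \<and>
     (if N = 0 then lam = [] else T!(N-1) = lam)}"

text \<open>P_lambda(x_1,...,x_N) with N = length lam; x_j is given as x (j-1).\<close>
definition Pfun :: "real \<Rightarrow> int list \<Rightarrow> (nat \<Rightarrow> 'a::{real_normed_field,banach}) \<Rightarrow> 'a" where
  "Pfun q lam x = (\<Sum>T\<in>GT (length lam) lam.
      \<Prod>j<length lam. Pskew q (T!j) (if j = 0 then [] else T!(j-1)) (x j))"

definition mq :: "real \<Rightarrow> nat \<Rightarrow> (nat \<Rightarrow> complex) \<Rightarrow> complex" where
  "mq q N z = 1 / ((2 * of_real pi * \<i>) ^ N * of_nat (fact N)) *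
     (\<Prod>i<N. \<Prod>j\<in>{i+1..<N}. qpinf q (z i / z j) * qpinf q (z j / z i))"

definition PiF :: "real \<Rightarrow> nat \<Rightarrow> (nat \<Rightarrow> complex) \<Rightarrow> (nat \<Rightarrow> real) \<Rightarrow> real \<Rightarrow> complex" where
  "PiF q N z alpha t = (\<Prod>i<N. \<Prod>j<N. inverse (qpinf q (of_real (alpha i) / z j))) *
     (\<Prod>j<N. exp (z j * of_real t))"

text \<open>Integral over the torus T^N of prod_i dz_i/z_i f(z), via z_j = exp(i theta_j),
  theta_j in [0, 2 pi], so that dz_j/z_j = i d theta_j.\<close>
definition torus_int :: "nat \<Rightarrow> ((nat \<Rightarrow> complex) \<Rightarrow> complex) \<Rightarrow> complex" where
  "torus_int N f = \<i> ^ N *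
     (\<integral>\<theta>. f (\<lambda>j. exp (\<i> * of_real (\<theta> j)))
        \<partial>(Pi\<^sub>M {..<N} (\<lambda>_. restrict_space lborel {0..2*pi})))"

definition Qfun :: "real \<Rightarrow> int list \<Rightarrow> (nat \<Rightarrow> real) \<Rightarrow> real \<Rightarrow> complex" where
  "Qfun q lam alpha t = (if \<not> is_sig lam then 0 else
     of_real (\<Prod>i<length lam - 1. qpinf q (q powi (lam!i - lam!(i+1) + 1))) *
     torus_int (length lam) (\<lambda>z. Pfun q lam (\<lambda>j. 1 / z j) * PiF q (length lam) z alpha t
                                   * mq q (length lam) z))"

end

theory Submission
  imports Defs
begin

text \<open>
  Writing \<open>P\<^bsub>\<lambda>/\<mu>\<^esub>(a)\<close> as \<open>a\<^bsup>|\<lambda>|-|\<mu>|\<^esup>\<close> times a product of Gaussian binomials, one for each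
  pair of gaps \<open>\<lambda>\<^sub>i - \<mu>\<^sub>i, \<mu>\<^sub>i - \<lambda>\<^sub>i\<^sub>+\<^sub>1\<close>, identity (1) follows by induction on \<open>k\<close>: appending a part
  multiplies the old terms by the Gaussian binomial of the new gap pair, and the two new terms are
  matched by two q-Pascal type relations.  Reflecting \<open>\<lambda> \<mapsto> -reverse \<lambda>\<close> gives the dual identity,
  which lowers parts of \<open>\<lambda>\<close> instead.  Combined with the branching rule
  \<open>P\<^sub>\<lambda>(x\<^sub>1,\<dots>,x\<^sub>n) = \<Sum>\<^sub>\<mu> P\<^sub>\<mu>(x\<^sub>1,\<dots>,x\<^sub>n\<^sub>-\<^sub>1) P\<^bsub>\<lambda>/\<mu>\<^esub>(x\<^sub>n)\<close> it yields, by induction on \<open>n\<close>,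
  the Pieri rule \<open>(\<Sum>\<^sub>j 1/x\<^sub>j) P\<^sub>\<lambda> = \<Sum>\<^sub>l (1 - q\<^bsup>\<lambda>\<^sub>l - \<lambda>\<^sub>l\<^sub>+\<^sub>1\<^esup>) P\<^bsub>\<lambda>-1\<^sub>l\<^esub>\<close>.

  For (2), the only \<open>t\<close>-dependence of \<open>Q\<^sub>\<lambda>(\<alpha>,t)\<close> is the factor \<open>e\<^bsup>t \<Sigma> z\<^sub>j\<^esup>\<close> of \<open>\<Pi>\<close>.  Differentiating
  under the integral over the torus (all other factors are bounded there) brings down
  \<open>\<Sum> z\<^sub>j = \<Sum> 1/x\<^sub>j\<close> with \<open>x\<^sub>j = 1/z\<^sub>j\<close>; the Pieri rule expands it, and the shift
  \<open>(x;q)\<^sub>\<infinity> = (1-x)(xq;q)\<^sub>\<infinity>\<close> in the prefactor of \<open>Q\<^sub>\<lambda>\<close> turns the coefficients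
  \<open>1 - q\<^bsup>\<lambda>\<^sub>l - \<lambda>\<^sub>l\<^sub>+\<^sub>1\<^esup>\<close> into \<open>1 - q\<^bsup>\<lambda>\<^sub>l\<^sub>-\<^sub>1 - \<lambda>\<^sub>l + 1\<^esup>\<close>.
\<close>

section \<open>q-Pochhammer symbols and Gaussian binomials\<close>

lemma qpinf_convergent_prod:
  fixes x :: "'a::{real_normed_field,banach}"
  assumes "\<bar>q\<bar> < 1"
  shows "convergent_prod (\<lambda>k. 1 - x * of_real q ^ k)"
proof -
  have "summable (\<lambda>k. norm x * \<bar>q\<bar> ^ k)"
    using assms by (intro summable_mult summable_geometric) simp
  then have "summable (\<lambda>k. norm ((1 - x * of_real q ^ k) - 1))"
    by (simp add: norm_mult norm_power)
  then show ?thesis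
    by (intro abs_convergent_prod_imp_convergent_prod summable_imp_abs_convergent_prod)
qed

lemma qpinf_LIMSEQ:
  fixes x :: "'a::{real_normed_field,banach}"
  assumes "\<bar>q\<bar> < 1"
  shows "(\<lambda>n. \<Prod>k\<le>n. 1 - x * of_real q ^ k) \<longlonglongrightarrow> qpinf q x"
  unfolding qpinf_def by (rule convergent_prod_LIMSEQ[OF qpinf_convergent_prod[OF assms]])

lemma qpinf_shift:
  fixes x :: "'a::{real_normed_field,banach}"
  assumes "\<bar>q\<bar> < 1"
  shows "qpinf q x = (1 - x) * qpinf q (x * of_real q)"
proof -
  have "(\<lambda>k. 1 - (x * of_real q) * of_real q ^ k) has_prod qpinf q (x * of_real q)"
    unfolding qpinf_def by (rule convergent_prod_has_prod[OF qpinf_convergent_prod[OF assms]])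
  then have "(\<lambda>n. (\<lambda>k. 1 - x * of_real q ^ k) (Suc n)) has_prod qpinf q (x * of_real q)"
    by (simp add: mult.assoc mult.commute)
  from has_prod_Suc_imp[OF this]
  have "(\<lambda>k. 1 - x * of_real q ^ k) has_prod (qpinf q (x * of_real q) * (1 - x))" by simp
  then show ?thesis unfolding qpinf_def
    by (simp add: has_prod_iff mult.commute)
qed

lemma qpinf_pos:
  fixes q x :: real
  assumes "0 < q" "q < 1" "0 \<le> x" "x < 1"
  shows "qpinf q x > 0"
proof -
  have factor_pos: "1 - x * q ^ k > 0" for k
  proof -
    have "x * q ^ k \<le> x" using assms by (simp add: mult_left_le power_le_one)
    then show ?thesis using assms by simp
  qed
  have "prodinf (\<lambda>k. 1 - x * q ^ k) \<noteq> 0"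
    using qpinf_convergent_prod[of q x] assms factor_pos
    by (intro prodinf_nonzero) (auto simp: less_le)
  then have "qpinf q x \<noteq> 0" by (simp add: qpinf_def)
  moreover have "\<forall>n. (\<Prod>k\<le>n. 1 - x * q ^ k) \<ge> 0"
    using factor_pos by (simp add: prod_nonneg less_imp_le)
  then have "qpinf q x \<ge> 0"
    using qpinf_LIMSEQ[of q x] assms by (intro LIMSEQ_le_const) auto
  ultimately show ?thesis by simp
qed

definition qfact :: "real \<Rightarrow> nat \<Rightarrow> real" where
  "qfact q n = qpoch q q (int n)"

lemma qfact_0: assumes "0 < q" "q < 1" shows "qfact q 0 = 1"
  using qpinf_pos[of q q] assms by (simp add: qfact_def qpoch_def)

lemma qfact_Suc:
  assumes "0 < q" "q < 1"
  shows "qfact q (Suc n) = qfact q n * (1 - q ^ Suc n)"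
proof -
  have shift: "qpinf q (q ^ Suc n) = (1 - q ^ Suc n) * qpinf q (q ^ Suc n * q)"
    using qpinf_shift[of q "q ^ Suc n"] assms by simp
  have "qpinf q (q ^ Suc n * q) > 0"
    using qpinf_pos[of q "q ^ Suc n * q"] assms power_Suc_less_one[of q "Suc n"]
    by (simp add: mult.commute)
  moreover have "1 - q ^ Suc n > 0" using power_Suc_less_one[OF assms] by simp
  moreover have powers: "q * q powi int n = q ^ Suc n" "q * q powi int (Suc n) = q ^ Suc n * q"
    unfolding power_int_of_nat by simp_all
  ultimately show ?thesis
    unfolding qfact_def qpoch_def powers shift by (simp add: field_simps)
qed

lemma qfact_pos: assumes "0 < q" "q < 1" shows "qfact q n > 0"
proof (induction n)
  case (Suc n)
  then show ?case using qfact_Suc[OF assms] power_Suc_less_one[OF assms, of n] by simp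
qed (simp add: qfact_0[OF assms])

text \<open>The Gaussian binomial \<open>[A+B, A]\<^sub>q\<close>, extended by \<open>0\<close> when \<open>A < 0\<close> or \<open>B < 0\<close>.\<close>
definition qbin :: "real \<Rightarrow> int \<Rightarrow> int \<Rightarrow> real" where
  "qbin q A B = qpoch q q (A + B) * qqinv q A * qqinv q B"

lemma qbin_neg_left: "A < 0 \<Longrightarrow> qbin q A B = 0"
  by (simp add: qbin_def qqinv_def)

lemma qbin_neg_right: "B < 0 \<Longrightarrow> qbin q A B = 0"
  by (simp add: qbin_def qqinv_def)

lemma qbin_commute: "qbin q A B = qbin q B A"
  by (simp add: qbin_def add.commute)

lemma qbin_of_nat: "qbin q (int a) (int b) = qfact q (a + b) / (qfact q a * qfact q b)"
  by (simp add: qbin_def qqinv_def qfact_def)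

lemma qbin_pred_right:
  assumes "0 < q" "q < 1"
  shows "(1 - q powi (A + B)) * qbin q A (B - 1) = (1 - q powi B) * qbin q A B"
proof (cases "A < 0 \<or> B < 1")
  case True
  then consider "A < 0" | "B < 0" | "B = 0" by linarith
  then show ?thesis by cases (simp_all add: qbin_neg_left qbin_neg_right)
next
  case False
  define a b where "a = nat A" and "b = nat (B - 1)"
  have ab: "A = int a" "B = int (Suc b)" using False by (simp_all add: a_def b_def)
  define Y where "Y = q ^ Suc b"
  define Z where "Z = q ^ Suc (a + b)"
  have powers: "q powi B = Y" "q powi (A + B) = Z"
    unfolding ab Y_def Z_def by (simp_all only: of_nat_add[symmetric] power_int_of_nat add_Suc_right)
  have "qbin q A (B - 1) = qfact q (a + b) / (qfact q a * qfact q b)"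
    using qbin_of_nat[of q a b] ab by simp
  moreover have "qbin q A B = qfact q (a + b) * (1 - Z) / (qfact q a * (qfact q b * (1 - Y)))"
    using qbin_of_nat[of q a "Suc b"] ab by (simp add: qfact_Suc[OF assms] Y_def Z_def)
  moreover have "1 - Y \<noteq> 0" using power_Suc_less_one[OF assms, of b] by (simp add: Y_def)
  ultimately show ?thesis unfolding powers by simp
qed

lemma qbin_recurrence:
  assumes "0 < q" "q < 1" "A + B \<ge> 0"
  shows "(1 - y) * qbin q (A + 1) B - (1 - y * q powi (A + 1)) * qbin q (A + 1) (B - 1)
         = (q powi B - y) * qbin q A B"
proof -
  consider "B < 0" | "A < -1" | "A = -1" "B \<ge> 1" | "A \<ge> 0" "B = 0" | "A \<ge> 0" "B \<ge> 1"
    using assms by linarith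
  then show ?thesis
  proof cases
    case 3
    define b where "b = nat (B - 1)"
    have "B = int (Suc b)" using 3 by (simp add: b_def)
    then show ?thesis
      using 3 qbin_of_nat[of q 0 "Suc b"] qbin_of_nat[of q 0 b] qfact_pos[OF assms(1,2)]
      by (simp add: qbin_neg_left less_le)
  next
    case 4
    then obtain a where "A = int a" using nonneg_int_cases by blast
    then show ?thesis
      using 4 qbin_of_nat[of q "Suc a" 0] qbin_of_nat[of q a 0] qfact_pos[OF assms(1,2)]
      by (simp add: qbin_neg_right less_le add.commute)
  next
    case 5
    define a b where "a = nat A" and "b = nat (B - 1)"
    have ab: "A = int a" "B = int (Suc b)" using 5 by (simp_all add: a_def b_def)
    define X where "X = q ^ Suc a"
    define Y where "Y = q ^ Suc b"
    define c where "c = qfact q (Suc (a + b)) / (qfact q a * qfact q b * (1 - X) * (1 - Y))"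
    have powers: "q powi (A + 1) = X" "q powi B = Y"
      using power_int_of_nat[of q "Suc a"] power_int_of_nat[of q "Suc b"]
      unfolding ab X_def Y_def by (simp_all add: add.commute)
    have XY: "1 - X \<noteq> 0" "1 - Y \<noteq> 0"
      using power_Suc_less_one[OF assms(1,2), of a] power_Suc_less_one[OF assms(1,2), of b]
      by (simp_all add: X_def Y_def)
    have "qfact q a \<noteq> 0" "qfact q b \<noteq> 0" using qfact_pos[OF assms(1,2)] by (simp_all add: less_le)
    note nonzero = XY this
    have qfact_Suc': "qfact q (Suc a) = qfact q a * (1 - X)" "qfact q (Suc b) = qfact q b * (1 - Y)"
      "qfact q (Suc (Suc (a + b))) = qfact q (Suc (a + b)) * (1 - X * Y)"
      by (simp_all add: qfact_Suc[OF assms(1,2)] X_def Y_def power_add)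
    have "qbin q (A + 1) B = qfact q (Suc (Suc (a + b))) / (qfact q (Suc a) * qfact q (Suc b))"
      using qbin_of_nat[of q "Suc a" "Suc b"] ab by (simp add: add.commute)
    then have raised: "qbin q (A + 1) B = c * (1 - X * Y)"
      unfolding qfact_Suc' c_def using nonzero by (simp add: divide_simps ac_simps)
    have "qbin q (A + 1) (B - 1) = qfact q (Suc (a + b)) / (qfact q (Suc a) * qfact q b)"
      using qbin_of_nat[of q "Suc a" b] ab by (simp add: add.commute)
    then have shifted: "qbin q (A + 1) (B - 1) = c * (1 - Y)"
      unfolding qfact_Suc' c_def using nonzero by (simp add: divide_simps ac_simps)
    have "qbin q A B = qfact q (Suc (a + b)) / (qfact q a * qfact q (Suc b))"
      using qbin_of_nat[of q a "Suc b"] ab by (simp add: add.commute)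
    then have original: "qbin q A B = c * (1 - X)"
      unfolding qfact_Suc' c_def using nonzero by (simp add: divide_simps ac_simps)
    show ?thesis unfolding powers raised shifted original by (simp add: algebra_simps)
  qed (simp_all add: qbin_neg_left qbin_neg_right)
qed

section \<open>Skew functions\<close>

definition skew_weight :: "real \<Rightarrow> nat \<Rightarrow> (nat \<Rightarrow> int) \<Rightarrow> (nat \<Rightarrow> int) \<Rightarrow> real" where
  "skew_weight q k L M = (\<Prod>i<k-1. qbin q (L i - M i) (M i - L (Suc i)))"

text \<open>With \<open>L l = \<lambda>\<^sub>l\<^sub>+\<^sub>1\<close> and 1-based \<open>l\<close>: \<open>gap_factor_prev q c L l = 1 - q\<^bsup>\<lambda>\<^sub>l\<^sub>-\<^sub>1 - \<lambda>\<^sub>l + c\<^esup>\<close> with \<open>\<lambda>\<^sub>0 = +\<infinity>\<close>,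
  and \<open>gap_factor_next q c n L l = 1 - q\<^bsup>\<lambda>\<^sub>l - \<lambda>\<^sub>l\<^sub>+\<^sub>1 + c\<^esup>\<close> with \<open>\<lambda>\<^sub>n\<^sub>+\<^sub>1 = -\<infinity>\<close>.\<close>
definition gap_factor_prev :: "real \<Rightarrow> int \<Rightarrow> (nat \<Rightarrow> int) \<Rightarrow> nat \<Rightarrow> real" where
  "gap_factor_prev q c L l = (if l = 1 then 1 else 1 - q powi (L (l - 2) - L (l - 1) + c))"

definition gap_factor_next :: "real \<Rightarrow> int \<Rightarrow> nat \<Rightarrow> (nat \<Rightarrow> int) \<Rightarrow> nat \<Rightarrow> real" where
  "gap_factor_next q c n L l = (if l = n then 1 else 1 - q powi (L (l - 1) - L l + c))"

lemma skew_weight_Suc: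
  "skew_weight q (Suc (Suc n)) L M = skew_weight q (Suc n) L M * qbin q (L n - M n) (M n - L (Suc n))"
  by (simp add: skew_weight_def)

lemma skew_weight_cong:
  "(\<And>i. i \<le> n \<Longrightarrow> L' i = L i) \<Longrightarrow> (\<And>i. i < n \<Longrightarrow> M' i = M i) \<Longrightarrow>
   skew_weight q (Suc n) L' M' = skew_weight q (Suc n) L M"
  unfolding skew_weight_def by (intro prod.cong) auto

lemma skew_weight_raise_last:
  assumes "0 < q" "q < 1"
  shows "gap_factor_prev q 0 L (Suc n) * skew_weight q (Suc n) (L(n := L n + 1)) M
       = (1 - (if n = 0 then 0 else q powi (M (n - 1) - L n))) * skew_weight q (Suc n) L M"
proof (cases n)
  case (Suc m)
  define A B where "A = L m - M m" and "B = M m - L (Suc m)"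
  have "skew_weight q (Suc m) (L(Suc m := L (Suc m) + 1)) M = skew_weight q (Suc m) L M"
    by (rule skew_weight_cong) auto
  then have "gap_factor_prev q 0 L (Suc n) * skew_weight q (Suc n) (L(n := L n + 1)) M
      = skew_weight q (Suc m) L M * ((1 - q powi (A + B)) * qbin q A (B - 1))"
    by (simp add: Suc skew_weight_Suc gap_factor_prev_def A_def B_def algebra_simps)
  also have "\<dots> = skew_weight q (Suc m) L M * ((1 - q powi B) * qbin q A B)"
    by (simp add: qbin_pred_right[OF assms])
  finally show ?thesis by (simp add: Suc skew_weight_Suc A_def B_def)
qed (simp add: skew_weight_def gap_factor_prev_def)

lemma sum_skew_weight_Suc_Suc:
  "(\<Sum>l=1..n. f l * skew_weight q (Suc (Suc n)) (L(l-1 := L (l-1) + d)) (M(l-1 := M (l-1) + e)))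
   = qbin q (L n - M n) (M n - L (Suc n))
     * (\<Sum>l=1..n. f l * skew_weight q (Suc n) (L(l-1 := L (l-1) + d)) (M(l-1 := M (l-1) + e)))"
  unfolding sum_distrib_left by (intro sum.cong refl) (auto simp: skew_weight_Suc)

lemma skew_weight_Suc_raise_term:
  assumes "0 < q" "q < 1"
  shows "gap_factor_prev q 0 L (Suc n) * skew_weight q (Suc (Suc n)) (L(n := L n + 1)) M
       = (1 - (if n = 0 then 0 else q powi (M (n - 1) - L n))) * skew_weight q (Suc n) L M
         * qbin q (L n - M n + 1) (M n - L (Suc n))"
proof -
  have "skew_weight q (Suc (Suc n)) (L(n := L n + 1)) M
      = skew_weight q (Suc n) (L(n := L n + 1)) M * qbin q (L n - M n + 1) (M n - L (Suc n))"
    by (simp add: skew_weight_Suc algebra_simps)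
  then show ?thesis by (simp only: mult.assoc[symmetric] skew_weight_raise_last[OF assms])
qed

lemma skew_weight_Suc_lower_term:
  assumes "0 < q" "q < 1"
  shows "gap_factor_prev q 1 M (Suc n) * skew_weight q (Suc (Suc n)) L (M(n := M n - 1))
       = (1 - (if n = 0 then 0 else q powi (M (n - 1) - L n)) * q powi (L n - M n + 1))
         * skew_weight q (Suc n) L M * qbin q (L n - M n + 1) (M n - L (Suc n) - 1)"
proof -
  have gap: "gap_factor_prev q 1 M (Suc n)
      = 1 - (if n = 0 then 0 else q powi (M (n - 1) - L n)) * q powi (L n - M n + 1)"
  proof (cases n)
    case (Suc m)
    have "q powi (M m - L n) * q powi (L n - M n + 1) = q powi (M m - L n + (L n - M n + 1))"
      by (rule power_int_add[symmetric]) (use assms in simp)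
    then show ?thesis by (simp add: gap_factor_prev_def Suc algebra_simps)
  qed (simp add: gap_factor_prev_def)
  have "skew_weight q (Suc n) L (M(n := M n - 1)) = skew_weight q (Suc n) L M"
    by (rule skew_weight_cong) auto
  then have "skew_weight q (Suc (Suc n)) L (M(n := M n - 1))
      = skew_weight q (Suc n) L M * qbin q (L n - M n + 1) (M n - L (Suc n) - 1)"
    by (simp add: skew_weight_Suc algebra_simps)
  then show ?thesis by (simp only: gap mult.assoc)
qed

text \<open>Induction on the length: the old terms acquire the common factor \<open>qbin q A B\<close> of the new
  gap pair, and the two new terms are matched by \<open>qbin_recurrence\<close>.\<close>
lemma skew_weight_raise_identity:
  assumes q: "0 < q" "q < 1" and sorted: "\<forall>i. Suc i < Suc n \<longrightarrow> L (Suc i) \<le> L i"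
  shows "(\<Sum>l=1..Suc n. gap_factor_prev q 0 L l * skew_weight q (Suc n) (L(l-1 := L (l-1) + 1)) M)
      = skew_weight q (Suc n) L M
        + (\<Sum>l=1..n. gap_factor_prev q 1 M l * skew_weight q (Suc n) L (M(l-1 := M (l-1) - 1)))"
  using sorted
proof (induction n)
  case 0
  show ?case by (simp add: skew_weight_def gap_factor_prev_def)
next
  case (Suc n)
  define A B where "A = L n - M n" and "B = M n - L (Suc n)"
  define y where "y = (if n = 0 then 0 else q powi (M (n - 1) - L n))"
  define W G where "W = skew_weight q (Suc n) L M" and "G = qbin q A B"
  define S where "S = (\<Sum>l=1..n. gap_factor_prev q 1 M l * skew_weight q (Suc n) L (M(l-1 := M (l-1) - 1)))"
  have AB: "A + B \<ge> 0" using Suc.prems by (auto simp: A_def B_def)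
  have "(\<Sum>l=1..Suc n. gap_factor_prev q 0 L l * skew_weight q (Suc n) (L(l-1 := L (l-1) + 1)) M) = W + S"
    unfolding W_def S_def by (rule Suc.IH) (use Suc.prems in auto)
  then have IH: "(\<Sum>l=1..n. gap_factor_prev q 0 L l * skew_weight q (Suc n) (L(l-1 := L (l-1) + 1)) M)
      = W + S - (1 - y) * W"
    using skew_weight_raise_last[OF q, of L n M] by (simp add: sum.cl_ivl_Suc W_def y_def)
  have last: "gap_factor_prev q 0 L (Suc (Suc n)) * skew_weight q (Suc (Suc n)) (L(Suc n := L (Suc n) + 1)) M
      = (1 - q powi B) * (W * G)"
    using skew_weight_raise_last[OF q, of L "Suc n" M]
    by (simp add: skew_weight_Suc A_def B_def W_def G_def)
  have "(\<Sum>l=1..Suc (Suc n). gap_factor_prev q 0 L l * skew_weight q (Suc (Suc n)) (L(l-1 := L (l-1) + 1)) M)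
      = G * (W + S - (1 - y) * W) + (1 - y) * W * qbin q (A + 1) B + (1 - q powi B) * (W * G)"
    using sum_skew_weight_Suc_Suc[of "gap_factor_prev q 0 L" q n L 1 M 0] IH last
      skew_weight_Suc_raise_term[OF q, of L n M]
    by (simp add: sum.cl_ivl_Suc A_def B_def G_def W_def y_def)
  also have "\<dots> = W * G + G * S + (1 - y * q powi (A + 1)) * W * qbin q (A + 1) (B - 1)"
  proof -
    have "W * ((1 - y) * qbin q (A + 1) B - (1 - y * q powi (A + 1)) * qbin q (A + 1) (B - 1))
        = W * ((q powi B - y) * G)"
      using qbin_recurrence[OF q AB, of y] by (simp add: G_def)
    then show ?thesis by (simp add: algebra_simps)
  qed
  also have "\<dots> = skew_weight q (Suc (Suc n)) L M
      + (\<Sum>l=1..Suc n. gap_factor_prev q 1 M l * skew_weight q (Suc (Suc n)) L (M(l-1 := M (l-1) - 1)))"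
    using sum_skew_weight_Suc_Suc[of "gap_factor_prev q 1 M" q n L 0 M "-1"]
      skew_weight_Suc_lower_term[OF q, of M n L]
    by (simp add: sum.cl_ivl_Suc skew_weight_Suc W_def G_def A_def B_def S_def y_def)
  finally show ?case .
qed

definition reflect :: "nat \<Rightarrow> (nat \<Rightarrow> int) \<Rightarrow> nat \<Rightarrow> int" where
  "reflect n L i = - L (n - 1 - i)"

lemma skew_weight_reflect: "skew_weight q k (reflect k L) (reflect (k - 1) M) = skew_weight q k L M"
  unfolding skew_weight_def reflect_def
proof (rule prod.reindex_bij_witness[where i="\<lambda>i. k - 2 - i" and j="\<lambda>i. k - 2 - i"])
  fix i assume "i \<in> {..<k - 1}"
  then have "k - 1 - i = Suc (k - 2 - i)" "k - 1 - Suc i = k - 2 - i" "k - 1 - 1 - i = k - 2 - i"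
    by auto
  then show "qbin q (L (k - 2 - i) - M (k - 2 - i)) (M (k - 2 - i) - L (Suc (k - 2 - i)))
      = qbin q (- L (k - 1 - i) - - M (k - 1 - 1 - i)) (- M (k - 1 - 1 - i) - - L (k - 1 - Suc i))"
    by (simp add: qbin_commute)
qed auto

lemma gap_factor_next_reflect:
  assumes "1 \<le> l" "l \<le> n"
  shows "gap_factor_next q c n L (n + 1 - l) = gap_factor_prev q c (reflect n L) l"
proof (cases "l = 1")
  case False
  then have "n + 1 - l \<noteq> n" "n - 1 - (l - 2) = n + 1 - l" "n - 1 - (l - 1) = n + 1 - l - 1"
    "n + 1 - l - 1 = n - l" using assms by auto
  then show ?thesis using False by (simp add: gap_factor_next_def gap_factor_prev_def reflect_def)
qed (simp add: gap_factor_next_def gap_factor_prev_def)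

lemma skew_weight_reflect_raise:
  assumes "1 \<le> l" "l \<le> k"
  shows "skew_weight q k ((reflect k L)(l-1 := reflect k L (l-1) + d)) (reflect (k - 1) M)
       = skew_weight q k (L(k - l := L (k - l) - d)) M"
proof -
  obtain n where n: "k = Suc n" using assms by (cases k) auto
  have "skew_weight q k ((reflect k L)(l-1 := reflect k L (l-1) + d)) (reflect (k - 1) M)
      = skew_weight q k (reflect k (L(k - l := L (k - l) - d))) (reflect (k - 1) M)"
    unfolding n by (rule skew_weight_cong) (use assms n in \<open>auto simp: reflect_def\<close>)
  then show ?thesis by (simp only: skew_weight_reflect)
qed

lemma skew_weight_reflect_lower:
  assumes "1 \<le> l" "l \<le> k - 1"
  shows "skew_weight q k (reflect k L) ((reflect (k - 1) M)(l-1 := reflect (k - 1) M (l-1) - d))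
       = skew_weight q k L (M(k - 1 - l := M (k - 1 - l) + d))"
proof -
  obtain n where n: "k = Suc n" using assms by (cases k) auto
  have "skew_weight q k (reflect k L) ((reflect (k - 1) M)(l-1 := reflect (k - 1) M (l-1) - d))
      = skew_weight q k (reflect k L) (reflect (k - 1) (M(k - 1 - l := M (k - 1 - l) + d)))"
    unfolding n by (rule skew_weight_cong) (use assms n in \<open>auto simp: reflect_def\<close>)
  then show ?thesis by (simp only: skew_weight_reflect)
qed

text \<open>The mirror image of \<open>skew_weight_raise_identity\<close> under \<open>\<lambda> \<mapsto> -reverse \<lambda>\<close>.\<close>
lemma skew_weight_lower_identity:
  assumes q: "0 < q" "q < 1" and k: "1 \<le> k" and sorted: "\<forall>i. Suc i < k \<longrightarrow> L (Suc i) \<le> L i"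
  shows "(\<Sum>l=1..k. gap_factor_next q 0 k L l * skew_weight q k (L(l-1 := L (l-1) - 1)) M)
      = skew_weight q k L M
        + (\<Sum>m=1..k-1. gap_factor_next q 1 (k-1) M m * skew_weight q k L (M(m-1 := M (m-1) + 1)))"
proof -
  obtain n where n: "k = Suc n" using k by (cases k) auto
  define L' M' where "L' = reflect k L" and "M' = reflect (k - 1) M"
  have "\<forall>i. Suc i < Suc n \<longrightarrow> L' (Suc i) \<le> L' i"
  proof (intro allI impI)
    fix i assume "Suc i < Suc n"
    then have "Suc (k - 1 - Suc i) < k" "k - 1 - i = Suc (k - 1 - Suc i)" using n by auto
    then show "L' (Suc i) \<le> L' i" using sorted unfolding L'_def reflect_def by (metis neg_le_iff_le)
  qed
  then have "(\<Sum>l=1..k. gap_factor_prev q 0 L' l * skew_weight q k (L'(l-1 := L' (l-1) + 1)) M')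
      = skew_weight q k L' M'
        + (\<Sum>l=1..k-1. gap_factor_prev q 1 M' l * skew_weight q k L' (M'(l-1 := M' (l-1) - 1)))"
    unfolding n diff_Suc_1 by (rule skew_weight_raise_identity[OF q])
  also have "(\<Sum>l=1..k. gap_factor_prev q 0 L' l * skew_weight q k (L'(l-1 := L' (l-1) + 1)) M')
      = (\<Sum>l=1..k. gap_factor_next q 0 k L (k + 1 - l) * skew_weight q k (L(k - l := L (k - l) - 1)) M)"
    unfolding L'_def M'_def using gap_factor_next_reflect[of _ k] skew_weight_reflect_raise[of _ k]
    by (intro sum.cong refl) simp
  also have "\<dots> = (\<Sum>l=1..k. gap_factor_next q 0 k L l * skew_weight q k (L(l-1 := L (l-1) - 1)) M)"
    by (subst (2) sum.atLeastAtMost_rev) (simp add: n)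
  also have "(\<Sum>l=1..k-1. gap_factor_prev q 1 M' l * skew_weight q k L' (M'(l-1 := M' (l-1) - 1)))
      = (\<Sum>l=1..k-1. gap_factor_next q 1 (k-1) M (k - l) * skew_weight q k L (M(k - 1 - l := M (k - 1 - l) + 1)))"
    unfolding L'_def M'_def using gap_factor_next_reflect[of _ "k - 1"] skew_weight_reflect_lower[of _ k]
    by (intro sum.cong refl) simp
  also have "\<dots> = (\<Sum>m=1..k-1. gap_factor_next q 1 (k-1) M m * skew_weight q k L (M(m-1 := M (m-1) + 1)))"
    by (subst (2) sum.atLeastAtMost_rev) (simp add: n)
  finally show ?thesis unfolding L'_def M'_def skew_weight_reflect .
qed

lemma sum_list_update_group:
  "k < length xs \<Longrightarrow> sum_list (xs[k := x]) = sum_list xs - xs ! k + (x :: 'a :: ab_group_add)"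
proof (induction xs arbitrary: k)
  case (Cons y xs)
  then show ?case by (cases k) auto
qed simp

lemma nth_list_update_fun: "j < length xs \<Longrightarrow> nth (xs[j := v]) = (nth xs)(j := v)"
  by (auto simp: fun_eq_iff nth_list_update)

lemma is_sig_nth_mono: "is_sig lam \<Longrightarrow> i \<le> j \<Longrightarrow> j < length lam \<Longrightarrow> lam ! j \<le> lam ! i"
  unfolding is_sig_def by (cases "i = j") (auto simp: sorted_wrt_iff_nth_less)

lemma Pskew_eq_skew_weight:
  "Pskew q lam mu a = a powi (sum_list lam - sum_list mu) * of_real (skew_weight q (length lam) (nth lam) (nth mu))"
  unfolding Pskew_def skew_weight_def qbin_def by (simp add: mult.assoc)

lemma Pskew_raise_identity:
  fixes a :: real
  assumes q: "0 < q" "q < 1" and k: "1 \<le> k" "length lam = k" "is_sig lam" "length mu = k - 1"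
    and a: "0 < a"
  shows "(\<Sum>l=1..k. gap_factor_prev q 0 (nth lam) l * Pskew q (lam[l-1 := lam ! (l-1) + 1]) mu a)
      = a * Pskew q lam mu a
        + (\<Sum>l=1..k-1. gap_factor_prev q 1 (nth mu) l * Pskew q lam (mu[l-1 := mu ! (l-1) - 1]) a)"
proof -
  obtain n where n: "k = Suc n" using k by (cases k) auto
  define S L M where "S = sum_list lam - sum_list mu" and "L = nth lam" and "M = nth mu"
  have aS: "a powi (S + 1) = a * a powi S" using a by (simp add: power_int_add)
  have lhs: "gap_factor_prev q 0 (nth lam) l * Pskew q (lam[l-1 := lam ! (l-1) + 1]) mu a
      = a powi (S + 1) * (gap_factor_prev q 0 L l * skew_weight q k (L(l-1 := L (l-1) + 1)) M)"
    if "l \<in> {1..k}" for l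
  proof -
    have "l - 1 < length lam" using that k by auto
    then show ?thesis unfolding Pskew_eq_skew_weight using k
      by (simp add: sum_list_update_group nth_list_update_fun L_def M_def S_def algebra_simps)
  qed
  have rhs: "gap_factor_prev q 1 (nth mu) l * Pskew q lam (mu[l-1 := mu ! (l-1) - 1]) a
      = a powi (S + 1) * (gap_factor_prev q 1 M l * skew_weight q k L (M(l-1 := M (l-1) - 1)))"
    if "l \<in> {1..k-1}" for l
  proof -
    have "l - 1 < length mu" using that k by auto
    then show ?thesis unfolding Pskew_eq_skew_weight using k
      by (simp add: sum_list_update_group nth_list_update_fun L_def M_def S_def algebra_simps)
  qed
  have "(\<Sum>l=1..k. gap_factor_prev q 0 (nth lam) l * Pskew q (lam[l-1 := lam ! (l-1) + 1]) mu a)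
     = a powi (S + 1) * (\<Sum>l=1..k. gap_factor_prev q 0 L l * skew_weight q k (L(l-1 := L (l-1) + 1)) M)"
    unfolding sum_distrib_left using lhs by (rule sum.cong[OF refl])
  also have "\<dots> = a powi (S + 1) * (skew_weight q k L M
      + (\<Sum>l=1..k-1. gap_factor_prev q 1 M l * skew_weight q k L (M(l-1 := M (l-1) - 1))))"
    using skew_weight_raise_identity[OF q, of n L M] is_sig_nth_mono[OF k(3)] k(2)
    by (simp add: n L_def)
  also have "\<dots> = a * Pskew q lam mu a
      + (\<Sum>l=1..k-1. a powi (S + 1) * (gap_factor_prev q 1 M l * skew_weight q k L (M(l-1 := M (l-1) - 1))))"
    unfolding Pskew_eq_skew_weight aS using k by (simp add: algebra_simps sum_distrib_left L_def M_def S_def)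
  also have "\<dots> = a * Pskew q lam mu a
      + (\<Sum>l=1..k-1. gap_factor_prev q 1 (nth mu) l * Pskew q lam (mu[l-1 := mu ! (l-1) - 1]) a)"
    using rhs by simp
  finally show ?thesis .
qed

lemma Pskew_lower_identity:
  fixes a :: "'a::{real_normed_field,banach}"
  assumes q: "0 < q" "q < 1" and k: "1 \<le> k" "length lam = k" "is_sig lam" "length mu = k - 1"
    and a: "a \<noteq> 0"
  shows "(\<Sum>l=1..k. of_real (gap_factor_next q 0 k (nth lam) l) * Pskew q (lam[l-1 := lam ! (l-1) - 1]) mu a)
      = inverse a * Pskew q lam mu a
        + (\<Sum>m=1..k-1. of_real (gap_factor_next q 1 (k-1) (nth mu) m) * Pskew q lam (mu[m-1 := mu ! (m-1) + 1]) a)"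
proof -
  define S L M where "S = sum_list lam - sum_list mu" and "L = nth lam" and "M = nth mu"
  have aS: "a powi (S - 1) = inverse a * a powi S"
    using a power_int_add[of a S "-1"] by (simp add: power_int_minus mult.commute)
  have lhs: "of_real (gap_factor_next q 0 k (nth lam) l) * Pskew q (lam[l-1 := lam ! (l-1) - 1]) mu a
      = a powi (S - 1) * of_real (gap_factor_next q 0 k L l * skew_weight q k (L(l-1 := L (l-1) - 1)) M)"
    if "l \<in> {1..k}" for l
  proof -
    have "l - 1 < length lam" using that k by auto
    then show ?thesis unfolding Pskew_eq_skew_weight using k
      by (simp add: sum_list_update_group nth_list_update_fun L_def M_def S_def algebra_simps)
  qed
  have rhs: "of_real (gap_factor_next q 1 (k-1) (nth mu) m) * Pskew q lam (mu[m-1 := mu ! (m-1) + 1]) a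
      = a powi (S - 1) * of_real (gap_factor_next q 1 (k-1) M m * skew_weight q k L (M(m-1 := M (m-1) + 1)))"
    if "m \<in> {1..k-1}" for m
  proof -
    have "m - 1 < length mu" using that k by auto
    then show ?thesis unfolding Pskew_eq_skew_weight using k
      by (simp add: sum_list_update_group nth_list_update_fun L_def M_def S_def algebra_simps)
  qed
  have "(\<Sum>l=1..k. of_real (gap_factor_next q 0 k (nth lam) l) * Pskew q (lam[l-1 := lam ! (l-1) - 1]) mu a)
     = a powi (S - 1) * of_real (\<Sum>l=1..k. gap_factor_next q 0 k L l * skew_weight q k (L(l-1 := L (l-1) - 1)) M)"
    unfolding sum_distrib_left of_real_sum using lhs by (rule sum.cong[OF refl])
  also have "\<dots> = a powi (S - 1) * of_real (skew_weight q k L M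
      + (\<Sum>m=1..k-1. gap_factor_next q 1 (k-1) M m * skew_weight q k L (M(m-1 := M (m-1) + 1))))"
    using skew_weight_lower_identity[OF q k(1)] is_sig_nth_mono[OF k(3)] k(2) by (simp add: L_def)
  also have "\<dots> = inverse a * Pskew q lam mu a
      + (\<Sum>m=1..k-1. a powi (S - 1) * of_real (gap_factor_next q 1 (k-1) M m * skew_weight q k L (M(m-1 := M (m-1) + 1))))"
    unfolding Pskew_eq_skew_weight aS using k
    by (simp add: algebra_simps sum_distrib_left of_real_sum L_def M_def S_def)
  also have "\<dots> = inverse a * Pskew q lam mu a
      + (\<Sum>m=1..k-1. of_real (gap_factor_next q 1 (k-1) (nth mu) m) * Pskew q lam (mu[m-1 := mu ! (m-1) + 1]) a)"
    using rhs by simp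
  finally show ?thesis .
qed

section \<open>Branching and the Pieri rule\<close>

definition interlacing :: "int list \<Rightarrow> int list set" where
  "interlacing lam = {mu. interlace mu lam}"

definition lists_between :: "int \<Rightarrow> int \<Rightarrow> nat \<Rightarrow> int list set" where
  "lists_between lo hi n = {nu. set nu \<subseteq> {lo..hi} \<and> length nu = n}"

lemma finite_lists_between: "finite (lists_between lo hi n)"
  unfolding lists_between_def by (rule finite_lists_length_eq) simp

lemma is_sig_interlace: assumes "interlace mu lam" "is_sig lam" shows "is_sig mu"
proof -
  have "\<forall>i j. i < j \<and> j < length mu \<longrightarrow> mu!j \<le> mu!i"
  proof (intro allI impI)
    fix i j assume ij: "i < j \<and> j < length mu"
    have l: "length lam = Suc (length mu)" using assms(1) by (simp add: interlace_def)
    have "mu!j \<le> lam!j" using assms(1) ij by (simp add: interlace_def)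
    also have "\<dots> \<le> lam!(Suc i)" using is_sig_nth_mono[OF assms(2), of "Suc i" j] ij l by simp
    also have "\<dots> \<le> mu!i" using assms(1) ij by (simp add: interlace_def)
    finally show "mu!j \<le> mu!i" .
  qed
  then show ?thesis unfolding is_sig_def sorted_wrt_iff_nth_less by simp
qed

lemma interlacing_subset_lists_between:
  assumes sig: "is_sig lam" and len: "length lam = Suc n" "length lam' = Suc n"
    and close: "\<And>i. i < Suc n \<Longrightarrow> lam ! i - 1 \<le> lam' ! i \<and> lam' ! i \<le> lam ! i"
  shows "interlacing lam' \<subseteq> lists_between (lam ! n - 1) (lam ! 0) n"
proof
  fix nu assume "nu \<in> interlacing lam'"
  then have il: "interlace nu lam'" by (simp add: interlacing_def)
  then have lnu: "length nu = n" using len by (simp add: interlace_def)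
  have "nu ! i \<in> {lam ! n - 1..lam ! 0}" if "i < n" for i
  proof -
    have "lam' ! Suc i \<le> nu ! i" "nu ! i \<le> lam' ! i" using il that lnu by (auto simp: interlace_def)
    moreover have "lam ! n \<le> lam ! Suc i" "lam ! i \<le> lam ! 0"
      using is_sig_nth_mono[OF sig] that len by auto
    ultimately show ?thesis using close[of i] close[of "Suc i"] that by fastforce
  qed
  then show "nu \<in> lists_between (lam ! n - 1) (lam ! 0) n"
    using lnu by (auto simp: lists_between_def in_set_conv_nth)
qed

lemma finite_interlacing: assumes "is_sig lam" "length lam = Suc n" shows "finite (interlacing lam)"
  using interlacing_subset_lists_between[OF assms assms(2)] finite_lists_between by (rule finite_subset) simp

lemma GT_0: "GT 0 lam = (if lam = [] then {[]} else {})"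
  by (auto simp: GT_def)

lemma GT_empty: "\<not> is_sig lam \<or> length lam \<noteq> Suc n \<Longrightarrow> GT (Suc n) lam = {}"
  by (auto simp: GT_def)

lemma append_in_GT:
  assumes mu: "mu \<in> interlacing lam" and T: "T \<in> GT n mu" and lam: "is_sig lam" "length lam = Suc n"
  shows "T @ [lam] \<in> GT (Suc n) lam"
proof -
  have lenT: "length T = n" and lev: "\<forall>j<n. length (T!j) = j+1 \<and> is_sig (T!j)"
    and il: "\<forall>j. j+1 < n \<longrightarrow> interlace (T!j) (T!(j+1))" and last: "if n = 0 then mu = [] else T!(n-1) = mu"
    using T by (auto simp: GT_def)
  have "interlace ((T @ [lam])!j) ((T @ [lam])!(j+1))" if "j + 1 < Suc n" for j
  proof (cases "j + 1 < n")
    case False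
    then have "j + 1 = n" using that by simp
    then show ?thesis using last mu lenT by (auto simp: nth_append interlacing_def)
  qed (use il lenT in \<open>simp add: nth_append\<close>)
  moreover have "length ((T @ [lam])!j) = j+1 \<and> is_sig ((T @ [lam])!j)" if "j < Suc n" for j
    using that lev lenT lam by (cases "j < n") (auto simp: nth_append)
  ultimately show ?thesis using lenT by (simp add: GT_def nth_append)
qed

lemma GT_Suc_split:
  assumes T: "T \<in> GT (Suc n) lam"
  shows "T \<in> (\<lambda>(mu,T). T @ [lam]) ` (SIGMA mu:interlacing lam. GT n mu)"
proof -
  have lenT: "length T = Suc n" and lev: "\<forall>j<Suc n. length (T!j) = j+1 \<and> is_sig (T!j)"
    and il: "\<forall>j. j+1 < Suc n \<longrightarrow> interlace (T!j) (T!(j+1))" and last: "T!n = lam"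
    using T by (auto simp: GT_def)
  define mu where "mu = (if n = 0 then [] else T!(n-1))"
  have "T = take n T @ [lam]" using lenT last
    by (metis lessI take_Suc_conv_app_nth take_all order_refl)
  moreover have "mu \<in> interlacing lam"
  proof (cases "n = 0")
    case True then show ?thesis using lev last by (simp add: mu_def interlacing_def interlace_def)
  next
    case False
    then show ?thesis using il[rule_format, of "n-1"] last by (simp add: mu_def interlacing_def)
  qed
  moreover have "take n T \<in> GT n mu"
    unfolding GT_def using lenT lev il by (auto simp: mu_def)
  ultimately show ?thesis by force
qed

lemma GT_Suc:
  assumes "is_sig lam" "length lam = Suc n"
  shows "GT (Suc n) lam = (\<lambda>(mu,T). T @ [lam]) ` (SIGMA mu:interlacing lam. GT n mu)"
proof
  show "GT (Suc n) lam \<subseteq> (\<lambda>(mu,T). T @ [lam]) ` (SIGMA mu:interlacing lam. GT n mu)"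
    using GT_Suc_split by (rule subsetI)
  show "(\<lambda>(mu,T). T @ [lam]) ` (SIGMA mu:interlacing lam. GT n mu) \<subseteq> GT (Suc n) lam"
    using append_in_GT[OF _ _ assms] by auto
qed

lemma GT_finite: "finite (GT n lam)"
proof (induction n arbitrary: lam)
  case 0 then show ?case by (simp add: GT_0)
next
  case (Suc n)
  show ?case
  proof (cases "is_sig lam \<and> length lam = Suc n")
    case True
    then show ?thesis unfolding GT_Suc[OF conjunct1[OF True] conjunct2[OF True]]
      using finite_interlacing[of lam n] True Suc.IH by (intro finite_imageI finite_SigmaI) auto
  next
    case False then show ?thesis using GT_empty[of lam n] by auto
  qed
qed

lemma GT_inj: "inj_on (\<lambda>(mu,T). T @ [lam]) (SIGMA mu:interlacing lam. GT n mu)"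
proof (rule inj_onI, clarsimp)
  fix mu1 mu2 T assume "T \<in> GT n mu1" "T \<in> GT n mu2"
  then show "mu1 = mu2" by (cases "n = 0") (auto simp: GT_def)
qed

lemma Pfun_product_append:
  assumes T: "T \<in> GT n mu" and lmu: "length mu = n"
  shows "(\<Prod>j<Suc n. Pskew q ((T @ [lam])!j) (if j = 0 then [] else (T @ [lam])!(j-1)) (x j))
       = (\<Prod>j<n. Pskew q (T!j) (if j = 0 then [] else T!(j-1)) (x j)) * Pskew q lam mu (x n)"
proof -
  have lenT: "length T = n" and last: "(if n = 0 then [] else T!(n-1)) = mu"
    using T lmu by (auto simp: GT_def)
  have "(\<Prod>j<n. Pskew q ((T @ [lam])!j) (if j = 0 then [] else (T @ [lam])!(j-1)) (x j))
      = (\<Prod>j<n. Pskew q (T!j) (if j = 0 then [] else T!(j-1)) (x j))"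
    using lenT by (intro prod.cong) (auto simp: nth_append)
  moreover have "(if n = 0 then [] else (T @ [lam])!(n-1)) = mu"
    using last lenT by (auto simp: nth_append)
  ultimately show ?thesis using lenT by (simp add: nth_append)
qed

lemma Pfun_branching:
  fixes x :: "nat \<Rightarrow> 'a::{real_normed_field,banach}"
  assumes "is_sig lam" "length lam = Suc n"
  shows "Pfun q lam x = (\<Sum>mu\<in>interlacing lam. Pfun q mu x * Pskew q lam mu (x n))"
proof -
  define F where "F = (\<lambda>T. \<Prod>j<Suc n. Pskew q (T!j) (if j = 0 then [] else T!(j-1)) (x j))"
  have "Pfun q lam x = sum F (GT (Suc n) lam)" unfolding Pfun_def F_def using assms by simp
  also have "\<dots> = (\<Sum>(mu,T)\<in>(SIGMA mu:interlacing lam. GT n mu). F (T @ [lam]))"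
    unfolding GT_Suc[OF assms] by (subst sum.reindex[OF GT_inj]) (auto intro: sum.cong)
  also have "\<dots> = (\<Sum>mu\<in>interlacing lam. \<Sum>T\<in>GT n mu. F (T @ [lam]))"
    by (rule sum.Sigma[symmetric]) (auto intro: finite_interlacing[OF assms] GT_finite)
  also have "\<dots> = (\<Sum>mu\<in>interlacing lam. Pfun q mu x * Pskew q lam mu (x n))"
  proof (rule sum.cong[OF refl])
    fix mu assume "mu \<in> interlacing lam"
    then have lmu: "length mu = n" using assms by (simp add: interlacing_def interlace_def)
    then have "(\<Sum>T\<in>GT n mu. F (T @ [lam]))
        = (\<Sum>T\<in>GT n mu. \<Prod>j<n. Pskew q (T!j) (if j = 0 then [] else T!(j-1)) (x j)) * Pskew q lam mu (x n)"
      unfolding F_def sum_distrib_right by (intro sum.cong refl Pfun_product_append)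
    then show "(\<Sum>T\<in>GT n mu. F (T @ [lam])) = Pfun q mu x * Pskew q lam mu (x n)"
      unfolding Pfun_def lmu .
  qed
  finally show ?thesis .
qed

lemma Pskew_eq_0_if_not_interlace:
  assumes "length nu = length lam' - 1" "length lam' \<ge> 1" "nu \<notin> interlacing lam'"
  shows "Pskew q lam' nu a = 0"
proof -
  have "\<not> interlace nu lam'" using assms by (simp add: interlacing_def)
  then obtain l where l: "l < length nu" "\<not> (lam'!(l+1) \<le> nu!l \<and> nu!l \<le> lam'!l)"
    using assms unfolding interlace_def by auto
  have "qbin q (lam'!l - nu!l) (nu!l - lam'!(Suc l)) = 0"
    using l by (auto simp: qbin_neg_left qbin_neg_right)
  then have "skew_weight q (length lam') (nth lam') (nth nu) = 0"
    unfolding skew_weight_def using l assms by (intro prod_zero) (auto intro!: bexI[of _ l])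
  then show ?thesis by (simp add: Pskew_eq_skew_weight)
qed

lemma Pfun_eq_sum_lists_between:
  assumes sig: "is_sig lam" and len: "length lam = Suc n"
    and U: "interlacing lam \<subseteq> U" "finite U" "\<forall>nu\<in>U. length nu = n"
  shows "Pfun q lam x = (\<Sum>nu\<in>U. Pfun q nu x * Pskew q lam nu (x n))"
  unfolding Pfun_branching[OF sig len]
proof (rule sum.mono_neutral_left[OF U(2,1)], intro ballI)
  fix nu assume "nu \<in> U - interlacing lam"
  then show "Pfun q nu x * Pskew q lam nu (x n) = 0"
    using U(3) len by (simp add: Pskew_eq_0_if_not_interlace)
qed

lemma is_sig_lower:
  assumes "is_sig lam" "l \<in> {1..length lam}" "gap_factor_next q 0 (length lam) (nth lam) l \<noteq> 0"
  shows "is_sig (lam[l-1 := lam!(l-1) - 1])"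
proof -
  have c: "l = length lam \<or> lam!l < lam!(l-1)"
  proof (rule ccontr)
    assume "\<not> ?thesis"
    then have "l < length lam" "lam!l \<ge> lam!(l-1)" using assms(2) by auto
    moreover have "lam!l \<le> lam!(l-1)" using is_sig_nth_mono[OF assms(1), of "l-1" l] calculation by simp
    ultimately have "lam!(l-1) - lam!l = 0" by simp
    then show False using assms(3) \<open>l < length lam\<close> by (simp add: gap_factor_next_def)
  qed
  have "\<forall>i j. i < j \<and> j < length lam \<longrightarrow> lam[l-1 := lam!(l-1) - 1]!j \<le> lam[l-1 := lam!(l-1) - 1]!i"
  proof (intro allI impI)
    fix i j assume ij: "i < j \<and> j < length lam"
    have m: "lam!j \<le> lam!i" using is_sig_nth_mono[OF assms(1), of i j] ij by simp
    show "lam[l-1 := lam!(l-1) - 1]!j \<le> lam[l-1 := lam!(l-1) - 1]!i"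
    proof (cases "i = l - 1")
      case True
      then have "j \<ge> l" using ij assms(2) by auto
      then have "lam!j < lam!(l-1)" using c is_sig_nth_mono[OF assms(1), of l j] ij by auto
      then show ?thesis using True ij by (auto simp: nth_list_update)
    next
      case False
      have "lam[l-1 := lam!(l-1) - 1]!j \<le> lam!j" using ij by (cases "j = l - 1") (auto simp: nth_list_update)
      then show ?thesis using m ij False by (auto simp: nth_list_update)
    qed
  qed
  then show ?thesis unfolding is_sig_def sorted_wrt_iff_nth_less by simp
qed

lemma lists_between_raise_bij:
  assumes "i < n"
  shows "bij_betw (\<lambda>nu. nu[i := nu ! i + 1])
           {nu \<in> lists_between lo hi n. nu ! i \<noteq> hi} {mu \<in> lists_between lo hi n. mu ! i \<noteq> lo}"
proof -
  have update: "xs[i := v] \<in> lists_between lo hi n"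
    if "xs \<in> lists_between lo hi n" "v \<in> {lo..hi}" for xs v
    using set_update_subset_insert[of xs i v] that by (auto simp: lists_between_def)
  have entry: "i < length xs" "xs ! i \<in> {lo..hi}" if "xs \<in> lists_between lo hi n" for xs
  proof -
    have "set xs \<subseteq> {lo..hi}" "i < length xs" using that assms by (auto simp: lists_between_def)
    then show "i < length xs" "xs ! i \<in> {lo..hi}" by (auto dest: nth_mem)
  qed
  show ?thesis
    by (rule bij_betw_byWitness[where f' = "\<lambda>mu. mu[i := mu ! i - 1]"])
       (use update entry in fastforce)+
qed

text \<open>Lowering the \<open>m\<close>-th part of \<open>\<mu>\<close> in \<open>P\<^sub>\<mu>\<close> is traded for raising it in \<open>P\<^bsub>\<lambda>/\<mu>\<^esub>\<close>: the terms
  at the boundary of the box vanish because \<open>\<mu>\<close> then fails to interlace \<open>\<lambda>\<close>.\<close>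
lemma sum_lower_eq_sum_raise:
  fixes x :: "nat \<Rightarrow> 'a::{real_normed_field,banach}"
  assumes sig: "is_sig lam" and len: "length lam = Suc n" and m: "m \<in> {1..n}"
    and U: "U = lists_between (lam ! n - 1) (lam ! 0) n"
  shows "(\<Sum>mu\<in>U. of_real (gap_factor_next q 0 n (nth mu) m) * Pfun q (mu[m-1 := mu!(m-1) - 1]) x * Pskew q lam mu a)
       = (\<Sum>nu\<in>U. of_real (gap_factor_next q 1 n (nth nu) m) * Pfun q nu x * Pskew q lam (nu[m-1 := nu!(m-1) + 1]) a)"
proof -
  define f where "f = (\<lambda>mu. of_real (gap_factor_next q 0 n (nth mu) m) * Pfun q (mu[m-1 := mu!(m-1) - 1]) x * Pskew q lam mu a)"
  define g where "g = (\<lambda>nu. of_real (gap_factor_next q 1 n (nth nu) m) * Pfun q nu x * Pskew q lam (nu[m-1 := nu!(m-1) + 1]) a)"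
  define D where "D = {mu \<in> U. mu ! (m-1) \<noteq> lam ! n - 1}"
  define E where "E = {nu \<in> U. nu ! (m-1) \<noteq> lam ! 0}"
  have m1: "m - 1 < n" "Suc (m - 1) = m" using m by auto
  have lam_bounds: "lam ! n \<le> lam ! m" "lam ! (m-1) \<le> lam ! 0"
    using is_sig_nth_mono[OF sig] m len by auto
  have bottom: "f mu = 0" if "mu \<in> U - D" for mu
  proof -
    have lmu: "length mu = n" and "mu ! (m-1) = lam ! n - 1"
      using that by (auto simp: D_def U lists_between_def)
    then have "\<not> lam ! Suc (m-1) \<le> mu ! (m-1)" using m1 lam_bounds by simp
    then have "mu \<notin> interlacing lam" using m1 lmu by (auto simp: interlacing_def interlace_def)
    then show ?thesis using lmu len by (simp add: f_def Pskew_eq_0_if_not_interlace)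
  qed
  have top: "g nu = 0" if "nu \<in> U - E" for nu
  proof -
    have lnu: "length nu = n" and "nu ! (m-1) = lam ! 0"
      using that by (auto simp: E_def U lists_between_def)
    then have "\<not> nu[m-1 := nu ! (m-1) + 1] ! (m-1) \<le> lam ! (m-1)" using m1 lam_bounds by simp
    then have "nu[m-1 := nu ! (m-1) + 1] \<notin> interlacing lam"
      using m1 lnu by (auto simp: interlacing_def interlace_def)
    then show ?thesis using lnu len by (simp add: g_def Pskew_eq_0_if_not_interlace)
  qed
  have "sum f U = sum f D"
    using bottom by (intro sum.mono_neutral_right) (auto simp: D_def U finite_lists_between)
  also have "\<dots> = sum (f \<circ> (\<lambda>nu. nu[m-1 := nu ! (m-1) + 1])) E"
    using sum.reindex_bij_betw[OF lists_between_raise_bij[OF m1(1)], of f "lam ! n - 1" "lam ! 0"]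
    by (simp add: D_def E_def U)
  also have "\<dots> = sum g E"
  proof (rule sum.cong[OF refl])
    fix nu assume "nu \<in> E"
    then have "length nu = n" by (simp add: E_def U lists_between_def)
    then show "(f \<circ> (\<lambda>nu. nu[m-1 := nu ! (m-1) + 1])) nu = g nu"
      using m1 m by (auto simp: f_def g_def gap_factor_next_def nth_list_update diff_add_eq)
  qed
  also have "\<dots> = sum g U"
    using top by (intro sum.mono_neutral_left) (auto simp: E_def U finite_lists_between)
  finally show ?thesis unfolding f_def g_def .
qed

lemma Pfun_pieri_lhs:
  fixes x :: "nat \<Rightarrow> 'a::{real_normed_field,banach}"
  assumes sig: "is_sig lam" and len: "length lam = Suc n"
    and U: "U = lists_between (lam ! n - 1) (lam ! 0) n"
    and IH: "\<And>mu. is_sig mu \<Longrightarrow> length mu = n \<Longrightarrow> (\<Sum>j<n. inverse (x j)) * Pfun q mu x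
      = (\<Sum>m=1..n. of_real (gap_factor_next q 0 n (nth mu) m) * Pfun q (mu[m-1 := mu ! (m-1) - 1]) x)"
  shows "(\<Sum>j<Suc n. inverse (x j)) * Pfun q lam x
    = (\<Sum>mu\<in>U. inverse (x n) * Pfun q mu x * Pskew q lam mu (x n))
      + (\<Sum>m=1..n. \<Sum>nu\<in>U. of_real (gap_factor_next q 1 n (nth nu) m) * Pfun q nu x
                              * Pskew q lam (nu[m-1 := nu ! (m-1) + 1]) (x n))"
proof -
  have Ulen: "\<forall>nu\<in>U. length nu = n" by (simp add: U lists_between_def)
  have "Pfun q lam x = (\<Sum>mu\<in>U. Pfun q mu x * Pskew q lam mu (x n))"
    using interlacing_subset_lists_between[OF sig len len] Ulen
    by (intro Pfun_eq_sum_lists_between[OF sig len]) (auto simp: U finite_lists_between)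
  then have "(\<Sum>j<Suc n. inverse (x j)) * Pfun q lam x
      = (\<Sum>mu\<in>U. ((\<Sum>j<n. inverse (x j)) * Pfun q mu x) * Pskew q lam mu (x n))
        + (\<Sum>mu\<in>U. inverse (x n) * Pfun q mu x * Pskew q lam mu (x n))"
    by (simp add: sum_distrib_left sum_distrib_right sum.distrib algebra_simps)
  also have "(\<Sum>mu\<in>U. ((\<Sum>j<n. inverse (x j)) * Pfun q mu x) * Pskew q lam mu (x n))
      = (\<Sum>mu\<in>U. \<Sum>m=1..n. of_real (gap_factor_next q 0 n (nth mu) m) * Pfun q (mu[m-1 := mu ! (m-1) - 1]) x
                               * Pskew q lam mu (x n))"
  proof (rule sum.cong[OF refl])
    fix mu assume mu: "mu \<in> U"
    show "((\<Sum>j<n. inverse (x j)) * Pfun q mu x) * Pskew q lam mu (x n)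
        = (\<Sum>m=1..n. of_real (gap_factor_next q 0 n (nth mu) m) * Pfun q (mu[m-1 := mu ! (m-1) - 1]) x
                     * Pskew q lam mu (x n))"
    proof (cases "mu \<in> interlacing lam")
      case True
      then have "is_sig mu" using is_sig_interlace sig by (auto simp: interlacing_def)
      then show ?thesis using IH mu Ulen by (simp add: sum_distrib_right)
    next
      case False
      then show ?thesis using mu Ulen len by (simp add: Pskew_eq_0_if_not_interlace)
    qed
  qed
  also have "\<dots> = (\<Sum>m=1..n. \<Sum>nu\<in>U. of_real (gap_factor_next q 1 n (nth nu) m) * Pfun q nu x
                              * Pskew q lam (nu[m-1 := nu ! (m-1) + 1]) (x n))"
    by (subst sum.swap) (intro sum.cong refl sum_lower_eq_sum_raise[OF sig len _ U])
  finally show ?thesis by (simp add: add.commute)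
qed

lemma Pfun_pieri_rhs:
  fixes x :: "nat \<Rightarrow> 'a::{real_normed_field,banach}"
  assumes q: "0 < q" "q < 1" and x: "x n \<noteq> 0" and sig: "is_sig lam" and len: "length lam = Suc n"
    and U: "U = lists_between (lam ! n - 1) (lam ! 0) n"
  shows "(\<Sum>l=1..Suc n. of_real (gap_factor_next q 0 (Suc n) (nth lam) l) * Pfun q (lam[l-1 := lam ! (l-1) - 1]) x)
    = (\<Sum>mu\<in>U. inverse (x n) * Pfun q mu x * Pskew q lam mu (x n))
      + (\<Sum>m=1..n. \<Sum>nu\<in>U. of_real (gap_factor_next q 1 n (nth nu) m) * Pfun q nu x
                              * Pskew q lam (nu[m-1 := nu ! (m-1) + 1]) (x n))"
proof -
  have Ulen: "\<forall>nu\<in>U. length nu = n" by (simp add: U lists_between_def)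
  have "(\<Sum>l=1..Suc n. of_real (gap_factor_next q 0 (Suc n) (nth lam) l) * Pfun q (lam[l-1 := lam ! (l-1) - 1]) x)
      = (\<Sum>l=1..Suc n. \<Sum>nu\<in>U. of_real (gap_factor_next q 0 (Suc n) (nth lam) l)
                              * (Pfun q nu x * Pskew q (lam[l-1 := lam ! (l-1) - 1]) nu (x n)))"
  proof (rule sum.cong[OF refl])
    fix l assume l: "l \<in> {1..Suc n}"
    show "of_real (gap_factor_next q 0 (Suc n) (nth lam) l) * Pfun q (lam[l-1 := lam ! (l-1) - 1]) x
        = (\<Sum>nu\<in>U. of_real (gap_factor_next q 0 (Suc n) (nth lam) l)
                     * (Pfun q nu x * Pskew q (lam[l-1 := lam ! (l-1) - 1]) nu (x n)))"
    proof (cases "gap_factor_next q 0 (Suc n) (nth lam) l = 0")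
      case False
      then have sig': "is_sig (lam[l-1 := lam ! (l-1) - 1])" using is_sig_lower[OF sig, of l q] l len by simp
      have len': "length (lam[l-1 := lam ! (l-1) - 1]) = Suc n" using len by simp
      have "interlacing (lam[l-1 := lam ! (l-1) - 1]) \<subseteq> U"
        unfolding U using len l
        by (intro interlacing_subset_lists_between[OF sig len len']) (auto simp: nth_list_update)
      then have "Pfun q (lam[l-1 := lam ! (l-1) - 1]) x
          = (\<Sum>nu\<in>U. Pfun q nu x * Pskew q (lam[l-1 := lam ! (l-1) - 1]) nu (x n))"
        using Ulen by (intro Pfun_eq_sum_lists_between[OF sig' len']) (simp_all add: U finite_lists_between)
      then show ?thesis by (simp add: sum_distrib_left)
    qed simp
  qed
  also have "\<dots> = (\<Sum>nu\<in>U. Pfun q nu x * (\<Sum>l=1..Suc n. of_real (gap_factor_next q 0 (Suc n) (nth lam) l)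
                                          * Pskew q (lam[l-1 := lam ! (l-1) - 1]) nu (x n)))"
    by (subst sum.swap) (simp only: sum_distrib_left mult_ac)
  also have "\<dots> = (\<Sum>nu\<in>U. Pfun q nu x * (inverse (x n) * Pskew q lam nu (x n)
      + (\<Sum>m=1..n. of_real (gap_factor_next q 1 n (nth nu) m) * Pskew q lam (nu[m-1 := nu ! (m-1) + 1]) (x n))))"
    using Pskew_lower_identity[OF q _ len sig, of _ "x n"] x Ulen by (intro sum.cong refl) simp
  also have "\<dots> = (\<Sum>mu\<in>U. inverse (x n) * Pfun q mu x * Pskew q lam mu (x n))
      + (\<Sum>nu\<in>U. \<Sum>m=1..n. of_real (gap_factor_next q 1 n (nth nu) m) * Pfun q nu x
                              * Pskew q lam (nu[m-1 := nu ! (m-1) + 1]) (x n))"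
    by (simp only: distrib_left sum.distrib sum_distrib_left mult_ac)
  also have "(\<Sum>nu\<in>U. \<Sum>m=1..n. of_real (gap_factor_next q 1 n (nth nu) m) * Pfun q nu x
                              * Pskew q lam (nu[m-1 := nu ! (m-1) + 1]) (x n))
      = (\<Sum>m=1..n. \<Sum>nu\<in>U. of_real (gap_factor_next q 1 n (nth nu) m) * Pfun q nu x
                              * Pskew q lam (nu[m-1 := nu ! (m-1) + 1]) (x n))"
    by (rule sum.swap)
  finally show ?thesis .
qed

lemma Pfun_pieri:
  fixes x :: "nat \<Rightarrow> 'a::{real_normed_field,banach}"
  assumes q: "0 < q" "q < 1" and x: "\<forall>j. x j \<noteq> 0" and sig: "is_sig lam" and len: "length lam = n"
  shows "(\<Sum>j<n. inverse (x j)) * Pfun q lam x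
      = (\<Sum>l=1..n. of_real (gap_factor_next q 0 n (nth lam) l) * Pfun q (lam[l-1 := lam ! (l-1) - 1]) x)"
  using sig len
proof (induction n arbitrary: lam)
  case (Suc n)
  have "x n \<noteq> 0" using x by simp
  show ?case
    by (rule trans[OF Pfun_pieri_lhs[OF Suc.prems refl Suc.IH]
                      Pfun_pieri_rhs[where x = x, OF q \<open>x n \<noteq> 0\<close> Suc.prems refl, symmetric]])
qed simp

section \<open>Differentiation under the integral\<close>

lemma norm_exp_minus_one_minus_le:
  fixes z :: complex
  assumes "norm z \<le> 1 / 2"
  shows "norm (exp z - 1 - z) \<le> norm z ^ 2"
proof (cases "z = 0")
  case False
  have sums: "(\<lambda>k. z ^ (k + 2) /\<^sub>R fact (k + 2)) sums (exp z - (\<Sum>k<2. z ^ k /\<^sub>R fact k))"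
    by (intro sums_split_initial_segment exp_converges)
  have "summable (\<lambda>k. norm z ^ (k + 2) /\<^sub>R fact (k + 2))"
    using summable_norm_exp[of z]
    by (intro summable_norm summable_ignore_initial_segment)
       (auto simp: norm_power norm_divide divide_simps)
  also have "?this \<longleftrightarrow> summable (\<lambda>k. norm z ^ 2 * (norm z ^ k / fact (k +2)))"
    by (simp add: power_add mult_ac divide_simps power2_eq_square del: of_nat_Suc of_nat_add)
  also have "\<dots> \<longleftrightarrow> summable (\<lambda>k. norm z ^ k / fact (k + 2))"
    by (subst summable_cmult_iff) (use \<open>z \<noteq> 0\<close> in auto)
  finally have summable: "summable (\<lambda>k. norm z ^ k / fact (k + 2))" .
  have "exp z - 1 - z = (\<Sum>k. z ^ (k + 2) / fact (k + 2))"
    using sums by (simp add: sums_iff scaleR_conv_of_real divide_simps eval_nat_numeral)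
  also have "norm \<dots> \<le> (\<Sum>k. norm (z ^ (k + 2) / fact (k + 2)))"
    using summable_norm_exp[of z]
    by (intro summable_norm summable_ignore_initial_segment)
       (auto simp: norm_power norm_divide divide_simps)
  also have "\<dots> = (\<Sum>k. norm z ^ 2 * (norm z ^ k / fact (k + 2)))"
    by (simp add: power_add norm_power norm_divide mult_ac norm_mult power2_eq_square del: of_nat_Suc)
  also have "\<dots> = norm z ^ 2 * (\<Sum>k. norm z ^ k / fact (k + 2))"
    using summable by (rule suminf_mult)
  also have "\<dots> \<le> norm z ^ 2 * (1 / (1 - norm z) / 2)"
  proof (intro mult_left_mono, rule sums_le)
    show "(\<lambda>k. norm z ^ k / fact (k + 2)) sums (\<Sum>k. norm z ^ k / fact (k + 2))"
      using summable by blast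
    show "(\<lambda>k. norm z ^ k / 2) sums (1 / (1 - norm z) / 2)"
      using assms by (intro geometric_sums sums_divide) auto
  next
    fix k :: nat
    have "norm z ^ k / fact (k + 2) \<le> norm z ^ k / fact 2"
      by (intro divide_left_mono fact_mono) auto
    then show "norm z ^ k / fact (k + 2) \<le> norm z ^ k / 2"
      by simp
  qed (auto simp: divide_simps)
  also have "\<dots> \<le> norm z ^ 2 * 1"
    using assms by (intro mult_left_mono) (auto simp: field_simps)
  finally show ?thesis by simp
qed simp

lemma norm_exp_mult_of_real_le:
  fixes S :: complex
  assumes "norm S \<le> B"
  shows "norm (exp (S * of_real s)) \<le> exp (B * \<bar>s\<bar>)"
proof -
  have "norm (exp (S * of_real s)) = exp (Re (S * of_real s))" by (rule norm_exp_eq_Re)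
  also have "Re (S * of_real s) \<le> norm (S * of_real s)" by (rule complex_Re_le_cmod)
  also have "norm (S * of_real s) \<le> B * \<bar>s\<bar>" using assms by (simp add: norm_mult mult_right_mono)
  finally show ?thesis by simp
qed

lemma norm_exp_taylor_le:
  fixes S :: complex
  assumes S: "norm S \<le> B" and h: "\<bar>h\<bar> \<le> 1 / (2 * (B + 1))"
  shows "norm (exp (S * of_real h) - 1 - S * of_real h) \<le> B ^ 2 * h ^ 2"
proof -
  have B: "B \<ge> 0" using S norm_ge_zero order_trans by blast
  have Sh: "norm (S * of_real h) \<le> B * \<bar>h\<bar>" using S by (simp add: norm_mult mult_right_mono)
  also have "\<dots> \<le> B * (1 / (2 * (B + 1)))" using h B by (intro mult_left_mono)
  also have "\<dots> \<le> 1 / 2" using B by (simp add: field_simps)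
  finally have "norm (exp (S * of_real h) - 1 - S * of_real h) \<le> norm (S * of_real h) ^ 2"
    by (rule norm_exp_minus_one_minus_le)
  also have "\<dots> \<le> (B * \<bar>h\<bar>) ^ 2" using Sh by (intro power_mono) auto
  finally show ?thesis by (simp add: power_mult_distrib)
qed

lemma integrable_bounded_mult_exp:
  fixes G S :: "'b \<Rightarrow> complex"
  assumes "finite_measure M" and "G \<in> borel_measurable M" "S \<in> borel_measurable M"
    and "\<And>th. norm (G th) \<le> BG" "\<And>th. norm (S th) \<le> BS"
  shows "integrable M (\<lambda>th. G th * exp (S th * of_real s))"
proof -
  interpret finite_measure M by fact
  have "norm (G th * exp (S th * of_real s)) \<le> BG * exp (BS * \<bar>s\<bar>)" for th
    unfolding norm_mult using assms(4,5) norm_exp_mult_of_real_le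
    by (intro mult_mono) (auto intro: order_trans[OF norm_ge_zero])
  then show ?thesis
    by (intro integrable_const_bound[where B = "BG * exp (BS * \<bar>s\<bar>)"]) (use assms(2,3) in auto)
qed

lemma has_vector_derivative_of_quadratic_error:
  fixes f :: "real \<Rightarrow> 'a::real_normed_vector"
  assumes d: "d > 0"
    and bound: "\<And>y. \<bar>y - t\<bar> < d \<Longrightarrow> norm (f y - f t - (y - t) *\<^sub>R f') \<le> C * \<bar>y - t\<bar> ^ 2"
  shows "(f has_vector_derivative f') (at t)"
proof -
  have "((\<lambda>y. norm (f y - f t - (y - t) *\<^sub>R f') / norm (y - t)) \<longlongrightarrow> 0) (at t)"
  proof (rule Lim_null_comparison)
    have "\<forall>\<^sub>F y in at t. \<bar>y - t\<bar> < d"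
      using d by (auto simp: eventually_at dist_real_def intro!: exI[of _ d])
    then show "\<forall>\<^sub>F y in at t. norm (norm (f y - f t - (y - t) *\<^sub>R f') / norm (y - t)) \<le> C * \<bar>y - t\<bar>"
    proof eventually_elim
      case (elim y)
      show ?case
      proof (cases "y = t")
        case False
        then have "norm (f y - f t - (y - t) *\<^sub>R f') / \<bar>y - t\<bar> \<le> C * \<bar>y - t\<bar> ^ 2 / \<bar>y - t\<bar>"
          using bound[OF elim] by (intro divide_right_mono) auto
        also have "\<dots> = C * \<bar>y - t\<bar>"
          using False by (simp add: power2_eq_square del: power2_abs abs_mult_self_eq)
        finally show ?thesis by simp
      qed simp
    qed
    have "((\<lambda>y. C * \<bar>y - t\<bar>) \<longlongrightarrow> C * \<bar>t - t\<bar>) (at t)"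
      by (intro tendsto_intros)
    then show "((\<lambda>y. C * \<bar>y - t\<bar>) \<longlongrightarrow> 0) (at t)" by simp
  qed
  then show ?thesis
    unfolding has_vector_derivative_def has_derivative_iff_norm
    by (auto intro: bounded_linear_scaleR_left)
qed

text \<open>For bounded \<open>G\<close> and \<open>S\<close> on a finite measure space the Taylor remainder
  \<open>e\<^bsup>hS\<^esup> - 1 - hS\<close> is uniformly \<open>O(h\<^sup>2)\<close>.\<close>
lemma has_vector_derivative_integral_exp:
  fixes M :: "'b measure" and G S :: "'b \<Rightarrow> complex"
  assumes fin: "finite_measure M" and mG: "G \<in> borel_measurable M" and mS: "S \<in> borel_measurable M"
    and bG: "\<And>th. norm (G th) \<le> BG" and bS: "\<And>th. norm (S th) \<le> BS"
  shows "((\<lambda>s. \<integral>th. G th * exp (S th * of_real s) \<partial>M) has_vector_derivative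
           (\<integral>th. G th * S th * exp (S th * of_real t) \<partial>M)) (at t)"
proof -
  interpret finite_measure M by (rule fin)
  have BS: "BS \<ge> 0" and BG: "BG \<ge> 0" using bS bG norm_ge_zero order_trans by blast+
  have int: "integrable M (\<lambda>th. G th * exp (S th * of_real s))" for s
    by (rule integrable_bounded_mult_exp[OF fin mG mS bG bS])
  have "(\<lambda>th. G th * S th) \<in> borel_measurable M" using mG mS by measurable
  moreover have "norm (G th * S th) \<le> BG * BS" for th
    unfolding norm_mult by (rule mult_mono[OF bG bS BG norm_ge_zero])
  ultimately have intD: "integrable M (\<lambda>th. (G th * S th) * exp (S th * of_real t))"
    by (rule integrable_bounded_mult_exp[OF fin _ mS _ bS])
  define D where "D = (\<lambda>s. \<integral>th. G th * exp (S th * of_real s) \<partial>M)"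
  define D' where "D' = (\<integral>th. G th * S th * exp (S th * of_real t) \<partial>M)"
  define C where "C = measure M (space M) * (BG * exp (BS * \<bar>t\<bar>) * BS ^ 2)"
  have "norm (D y - D t - (y - t) *\<^sub>R D') \<le> C * \<bar>y - t\<bar> ^ 2"
    if y: "\<bar>y - t\<bar> < 1 / (2 * (BS + 1))" for y
  proof -
    define h where "h = y - t"
    define R where "R = (\<lambda>th. G th * exp (S th * of_real t) * (exp (S th * of_real h) - 1 - S th * of_real h))"
    have "D y - D t - (y - t) *\<^sub>R D' = (\<integral>th. G th * exp (S th * of_real y) - G th * exp (S th * of_real t)
               - of_real h * (G th * S th * exp (S th * of_real t)) \<partial>M)"
      unfolding D_def D'_def using int intD by (simp add: h_def scaleR_conv_of_real)
    also have "\<dots> = integral\<^sup>L M R"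
    proof (rule Bochner_Integration.integral_cong[OF refl])
      fix th
      have "exp (S th * of_real y) = exp (S th * of_real t) * exp (S th * of_real h)"
        by (simp add: h_def exp_add[symmetric] algebra_simps)
      then show "G th * exp (S th * of_real y) - G th * exp (S th * of_real t)
               - of_real h * (G th * S th * exp (S th * of_real t)) = R th"
        by (simp add: R_def algebra_simps)
    qed
    finally have eq: "D y - D t - (y - t) *\<^sub>R D' = integral\<^sup>L M R" .
    have R_bound: "norm (R th) \<le> BG * exp (BS * \<bar>t\<bar>) * BS ^ 2 * \<bar>h\<bar> ^ 2" for th
    proof -
      have "norm (R th) = norm (G th) * norm (exp (S th * of_real t))
          * norm (exp (S th * of_real h) - 1 - S th * of_real h)"
        by (simp add: R_def norm_mult)
      also have "\<dots> \<le> BG * exp (BS * \<bar>t\<bar>) * (BS ^ 2 * h ^ 2)"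
        using y norm_exp_taylor_le[OF bS, of h th] norm_exp_mult_of_real_le[OF bS, of th t]
        by (intro mult_mono bG BG norm_ge_zero mult_nonneg_nonneg) (auto simp: h_def)
      finally show ?thesis by (simp add: mult.assoc)
    qed
    have "R \<in> borel_measurable M" unfolding R_def using mG mS by measurable
    then have "integrable M (\<lambda>th. norm (R th))"
      using R_bound by (intro integrable_norm integrable_const_bound) auto
    then have "norm (integral\<^sup>L M R) \<le> (\<integral>th. BG * exp (BS * \<bar>t\<bar>) * BS ^ 2 * \<bar>h\<bar> ^ 2 \<partial>M)"
      using R_bound order_trans[OF integral_norm_bound integral_mono] by blast
    also have "\<dots> = C * \<bar>y - t\<bar> ^ 2" by (simp add: C_def h_def)
    finally show ?thesis unfolding eq .
  qed
  then have "(D has_vector_derivative D') (at t)"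
    using BS by (intro has_vector_derivative_of_quadratic_error[where d = "1 / (2 * (BS + 1))"]) auto
  then show ?thesis unfolding D_def D'_def .
qed

section \<open>The functions \<open>Q\<^sub>\<lambda>\<close>\<close>

lemma qpinf_norm_upper:
  fixes w :: "'a::{real_normed_field,banach}"
  assumes q: "0 \<le> q" "q < 1"
  shows "norm (qpinf q w) \<le> exp (norm w / (1 - q))"
proof -
  have aq: "\<bar>q\<bar> < 1" using q by simp
  have geo: "\<And>n. (\<Sum>k\<le>n. q ^ k) \<le> 1 / (1 - q)"
  proof -
    fix n
    have "(\<Sum>k<Suc n. q ^ k) \<le> (\<Sum>k. q ^ k)"
      by (rule sum_le_suminf) (use aq q in \<open>auto intro: summable_geometric\<close>)
    then show "(\<Sum>k\<le>n. q ^ k) \<le> 1 / (1 - q)" using aq by (simp add: suminf_geometric lessThan_Suc_atMost)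
  qed
  have bnd: "\<And>n. norm (\<Prod>k\<le>n. 1 - w * of_real q ^ k) \<le> exp (norm w / (1 - q))"
  proof -
    fix n
    have "norm (\<Prod>k\<le>n. 1 - w * of_real q ^ k) = (\<Prod>k\<le>n. norm (1 - w * of_real q ^ k))"
      by (rule prod_norm[symmetric])
    also have "\<dots> \<le> (\<Prod>k\<le>n. exp (norm w * q ^ k))"
    proof (rule prod_mono)
      fix k
      have "norm (1 - w * of_real q ^ k) \<le> norm (1::'a) + norm (w * of_real q ^ k)" by (rule norm_triangle_ineq4)
      also have "\<dots> = 1 + norm w * q ^ k" using q by (simp add: norm_mult norm_power)
      also have "\<dots> \<le> exp (norm w * q ^ k)" by (rule exp_ge_add_one_self)
      finally show "0 \<le> norm (1 - w * of_real q ^ k) \<and> norm (1 - w * of_real q ^ k) \<le> exp (norm w * q ^ k)"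
        by simp
    qed
    also have "\<dots> = exp (norm w * (\<Sum>k\<le>n. q ^ k))" by (simp add: exp_sum sum_distrib_left)
    also have "\<dots> \<le> exp (norm w * (1 / (1 - q)))"
      by (subst exp_le_cancel_iff) (rule mult_left_mono[OF geo[of n] norm_ge_zero])
    finally show "norm (\<Prod>k\<le>n. 1 - w * of_real q ^ k) \<le> exp (norm w / (1 - q))" by simp
  qed
  have "(\<lambda>n. norm (\<Prod>k\<le>n. 1 - w * of_real q ^ k)) \<longlonglongrightarrow> norm (qpinf q w)"
    by (intro tendsto_norm qpinf_LIMSEQ aq)
  then show ?thesis by (rule LIMSEQ_le_const2) (use bnd in auto)
qed

lemma qpinf_norm_lower:
  fixes w :: "'a::{real_normed_field,banach}"
  assumes q: "0 < q" "q < 1" and w: "norm w < 1"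
  shows "qpinf q (norm w) \<le> norm (qpinf q w)" "qpinf q (norm w) > 0"
proof -
  have aq: "\<bar>q\<bar> < 1" using q by simp
  have fpos: "\<And>k. 0 < 1 - norm w * q ^ k" "\<And>k. 1 - norm w * q ^ k \<le> 1"
  proof -
    fix k :: nat
    have "q ^ k \<le> 1" using q by (simp add: power_le_one)
    then have "norm w * q ^ k \<le> norm w" by (simp add: mult_left_le)
    then show "0 < 1 - norm w * q ^ k" using w by simp
    show "1 - norm w * q ^ k \<le> 1" using q by simp
  qed
  have R: "(\<lambda>n. \<Prod>k\<le>n. 1 - norm w * q ^ k) \<longlonglongrightarrow> qpinf q (norm w)"
    using qpinf_LIMSEQ[OF aq, of "norm w"] by simp
  have dec: "decseq (\<lambda>n. \<Prod>k\<le>n. 1 - norm w * q ^ k)"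
  proof (rule decseq_SucI)
    fix n
    have "(\<Prod>k\<le>Suc n. 1 - norm w * q ^ k) = (\<Prod>k\<le>n. 1 - norm w * q ^ k) * (1 - norm w * q ^ Suc n)"
      by simp
    also have "\<dots> \<le> (\<Prod>k\<le>n. 1 - norm w * q ^ k) * 1"
      by (intro mult_left_mono fpos prod_nonneg) (use fpos in \<open>auto intro: less_imp_le\<close>)
    finally show "(\<Prod>k\<le>Suc n. 1 - norm w * q ^ k) \<le> (\<Prod>k\<le>n. 1 - norm w * q ^ k)" by simp
  qed
  have bnd: "\<And>n. qpinf q (norm w) \<le> norm (\<Prod>k\<le>n. 1 - w * of_real q ^ k)"
  proof -
    fix n
    have "qpinf q (norm w) \<le> (\<Prod>k\<le>n. 1 - norm w * q ^ k)" by (rule decseq_ge[OF dec R])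
    also have "\<dots> \<le> (\<Prod>k\<le>n. norm (1 - w * of_real q ^ k))"
    proof (rule prod_mono)
      fix k
      have "norm (1::'a) - norm (w * of_real q ^ k) \<le> norm (1 - w * of_real q ^ k)" by (rule norm_triangle_ineq2)
      then show "0 \<le> 1 - norm w * q ^ k \<and> 1 - norm w * q ^ k \<le> norm (1 - w * of_real q ^ k)"
        using fpos[of k] q by (simp add: norm_mult norm_power)
    qed
    also have "\<dots> = norm (\<Prod>k\<le>n. 1 - w * of_real q ^ k)" by (rule prod_norm)
    finally show "qpinf q (norm w) \<le> norm (\<Prod>k\<le>n. 1 - w * of_real q ^ k)" .
  qed
  have "(\<lambda>n. norm (\<Prod>k\<le>n. 1 - w * of_real q ^ k)) \<longlonglongrightarrow> norm (qpinf q w)"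
    by (intro tendsto_norm qpinf_LIMSEQ aq)
  then show "qpinf q (norm w) \<le> norm (qpinf q w)" by (rule LIMSEQ_le_const) (use bnd in auto)
  show "qpinf q (norm w) > 0" using qpinf_pos[of q "norm w"] q w by simp
qed

lemma borel_measurable_qpinf_complex:
  assumes "\<bar>q\<bar> < 1"
  shows "(qpinf q :: complex \<Rightarrow> complex) \<in> borel_measurable borel"
proof (rule borel_measurable_LIMSEQ_metric)
  fix n
  show "(\<lambda>w::complex. \<Prod>k\<le>n. 1 - w * of_real q ^ k) \<in> borel_measurable borel"
    by (intro borel_measurable_continuous_onI continuous_intros)
next
  fix w :: complex
  show "(\<lambda>n. \<Prod>k\<le>n. 1 - w * of_real q ^ k) \<longlonglongrightarrow> qpinf q w" by (rule qpinf_LIMSEQ[OF assms])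
qed

lemma borel_measurable_qpinf[measurable]:
  assumes "\<bar>q\<bar> < 1" "f \<in> borel_measurable M"
  shows "(\<lambda>x. qpinf q (f x :: complex)) \<in> borel_measurable M"
  using measurable_compose[OF assms(2) borel_measurable_qpinf_complex[OF assms(1)]] by simp

lemma borel_measurable_powi[measurable]:
  fixes f :: "'b \<Rightarrow> complex"
  assumes "f \<in> borel_measurable M"
  shows "(\<lambda>x. f x powi k) \<in> borel_measurable M"
  unfolding power_int_def using assms by measurable




definition torus_measure :: "nat \<Rightarrow> (nat \<Rightarrow> real) measure" where
  "torus_measure N = Pi\<^sub>M {..<N} (\<lambda>_. restrict_space lborel {0..2*pi})"

definition torus_point :: "(nat \<Rightarrow> real) \<Rightarrow> nat \<Rightarrow> complex" where
  "torus_point th j = exp (\<i> * of_real (th j))"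

lemma finite_measure_torus: "finite_measure (torus_measure N)"
proof -
  let ?M0 = "restrict_space lborel {0..2*pi}"
  have M0: "finite_measure ?M0"
  proof (rule finite_measureI)
    have "emeasure ?M0 (space ?M0) = emeasure lborel {0..2*pi}"
      by (subst emeasure_restrict_space) auto
    then show "emeasure ?M0 (space ?M0) \<noteq> \<infinity>" by (simp add: emeasure_lborel_Icc_eq)
  qed
  interpret product_sigma_finite "\<lambda>_::nat. ?M0"
    unfolding product_sigma_finite_def using finite_measure.axioms(1)[OF M0] by simp
  show ?thesis
  proof (rule finite_measureI)
    have "emeasure (torus_measure N) (space (torus_measure N)) = (\<Prod>i<N. emeasure ?M0 (space ?M0))"
      unfolding torus_measure_def space_PiM by (subst emeasure_PiM) (use sets.top[of ?M0] in auto)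
    then show "emeasure (torus_measure N) (space (torus_measure N)) \<noteq> \<infinity>"
      using finite_measure.emeasure_finite[OF M0] by (simp add: power_eq_top_ennreal)
  qed
qed

lemma measurable_torus_point: "j < N \<Longrightarrow> (\<lambda>th. torus_point th j) \<in> borel_measurable (torus_measure N)"
proof -
  assume j: "j < N"
  have "(\<lambda>th. th j) \<in> measurable (torus_measure N) (restrict_space lborel {0..2*pi})"
    unfolding torus_measure_def using j by (intro measurable_component_singleton) auto
  moreover have "(\<lambda>r::real. exp (\<i> * of_real r)) \<in> borel_measurable (restrict_space lborel {0..2*pi})"
    by (intro measurable_restrict_space1) (simp add: borel_measurable_continuous_onI continuous_intros)
  ultimately show ?thesis unfolding torus_point_def by (rule measurable_compose)
qed

lemma norm_torus_point [simp]: "norm (torus_point th j) = 1"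
  by (simp add: torus_point_def norm_exp_eq_Re)

lemma torus_point_nonzero [simp]: "torus_point th j \<noteq> 0"
  by (simp add: torus_point_def)

lemma borel_measurable_Pfun:
  assumes "\<And>j. j < length lam \<Longrightarrow> (\<lambda>th. x th j) \<in> borel_measurable M"
  shows "(\<lambda>th. Pfun q lam (x th) :: complex) \<in> borel_measurable M"
  unfolding Pfun_def Pskew_def
  by (intro borel_measurable_sum borel_measurable_prod borel_measurable_times borel_measurable_powi
        borel_measurable_const assms) auto

lemma Pfun_bounded_on_unimodular:
  "\<exists>B. \<forall>x::nat \<Rightarrow> 'a::{real_normed_field,banach}. (\<forall>j. norm (x j) = 1) \<longrightarrow> norm (Pfun q lam x) \<le> B"
proof (intro exI allI impI)
  fix x :: "nat \<Rightarrow> 'a" assume x: "\<forall>j. norm (x j) = 1"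
  have "norm (Pfun q lam x) \<le> (\<Sum>T\<in>GT (length lam) lam.
      norm (\<Prod>j<length lam. Pskew q (T!j) (if j = 0 then [] else T!(j-1)) (x j)))"
    unfolding Pfun_def by (rule norm_sum)
  also have "\<dots> = (\<Sum>T\<in>GT (length lam) lam. \<Prod>j<length lam.
      \<bar>skew_weight q (length (T!j)) (nth (T!j)) (nth (if j = 0 then [] else T!(j-1)))\<bar>)"
    using x by (simp add: prod_norm[symmetric] Pskew_eq_skew_weight norm_mult norm_power_int)
  finally show "norm (Pfun q lam x) \<le> (\<Sum>T\<in>GT (length lam) lam. \<Prod>j<length lam.
      \<bar>skew_weight q (length (T!j)) (nth (T!j)) (nth (if j = 0 then [] else T!(j-1)))\<bar>)" .
qed

definition qpinf_inverse_prod :: "real \<Rightarrow> nat \<Rightarrow> (nat \<Rightarrow> real) \<Rightarrow> (nat \<Rightarrow> complex) \<Rightarrow> complex" where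
  "qpinf_inverse_prod q N alpha z = (\<Prod>i<N. \<Prod>j<N. inverse (qpinf q (of_real (alpha i) / z j)))"

lemma PiF_eq: "PiF q N z alpha t = qpinf_inverse_prod q N alpha z * exp ((\<Sum>j<N. z j) * of_real t)"
  unfolding PiF_def qpinf_inverse_prod_def by (simp add: sum_distrib_right exp_sum)

lemma norm_qpinf_inverse_prod_le:
  assumes q: "0 < q" "q < 1" and al: "\<forall>i<N. 0 \<le> alpha i \<and> alpha i < 1" and z: "\<forall>j. norm (z j) = 1"
  shows "norm (qpinf_inverse_prod q N alpha z) \<le> (\<Prod>i<N. \<Prod>j<N. 1 / qpinf q (alpha i))"
  unfolding qpinf_inverse_prod_def prod_norm[symmetric]
proof (intro prod_mono conjI norm_ge_zero)
  fix i j assume i: "i \<in> {..<N}"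
  have "norm (of_real (alpha i) / z j) = alpha i" using z al i by (simp add: norm_divide)
  then have lo: "qpinf q (alpha i) \<le> norm (qpinf q (of_real (alpha i) / z j))" "qpinf q (alpha i) > 0"
    using qpinf_norm_lower[OF q, of "of_real (alpha i) / z j"] al i by auto
  then have "inverse (norm (qpinf q (of_real (alpha i) / z j))) \<le> inverse (qpinf q (alpha i))"
    by (intro le_imp_inverse_le) auto
  then show "norm (inverse (qpinf q (of_real (alpha i) / z j))) \<le> 1 / qpinf q (alpha i)"
    by (simp add: norm_inverse inverse_eq_divide norm_divide)
qed (auto intro: prod_nonneg)

lemma norm_mq_le:
  assumes q: "0 < q" "q < 1" and z: "\<forall>j. norm (z j) = 1"
  shows "norm (mq q N z) \<le> norm (1 / ((2 * of_real pi * \<i>) ^ N * of_nat (fact N) :: complex))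
     * (\<Prod>i<N. \<Prod>j\<in>{i+1..<N}. exp (1 / (1 - q)) * exp (1 / (1 - q)))"
proof -
  have "norm (\<Prod>i<N. \<Prod>j\<in>{i+1..<N}. qpinf q (z i / z j) * qpinf q (z j / z i))
     \<le> (\<Prod>i<N. \<Prod>j\<in>{i+1..<N}. exp (1 / (1 - q)) * exp (1 / (1 - q)))"
    unfolding prod_norm[symmetric]
  proof (intro prod_mono conjI norm_ge_zero)
    fix i j
    have "norm (z i / z j) = 1" "norm (z j / z i) = 1" using z by (simp_all add: norm_divide)
    then show "norm (qpinf q (z i / z j) * qpinf q (z j / z i)) \<le> exp (1 / (1 - q)) * exp (1 / (1 - q))"
      unfolding norm_mult
      using qpinf_norm_upper[of q "z i / z j"] qpinf_norm_upper[of q "z j / z i"] q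
      by (intro mult_mono) auto
  qed (auto intro: prod_nonneg)
  then show ?thesis unfolding mq_def norm_mult by (rule mult_left_mono[OF _ norm_ge_zero])
qed

lemma prod_split_two:
  assumes "finite I" "a \<in> I \<Longrightarrow> b \<in> I \<Longrightarrow> a \<noteq> b"
  shows "prod g I = prod g (I - {a, b}) * (if a \<in> I then g a else 1) * (if b \<in> I then g b else 1)"
proof -
  have r: "\<And>J x. finite J \<Longrightarrow> x \<in> J \<Longrightarrow> prod g J = g x * prod g (J - {x})" by (rule prod.remove)
  consider "a \<in> I" "b \<in> I" | "a \<in> I" "b \<notin> I" | "a \<notin> I" "b \<in> I" | "a \<notin> I" "b \<notin> I" by blast
  then show ?thesis
  proof cases
    case 1
    have "prod g I = g a * prod g (I - {a})" using r[OF assms(1) 1(1)] .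
    also have "prod g (I - {a}) = g b * prod g (I - {a} - {b})"
      using r[of "I - {a}" b] assms 1 by auto
    also have "I - {a} - {b} = I - {a, b}" by auto
    finally show ?thesis using 1 by (simp add: mult_ac)
  next
    case 2
    have "I - {a, b} = I - {a}" using 2 by auto
    then show ?thesis using r[OF assms(1) 2(1)] 2 by (simp add: mult_ac)
  next
    case 3
    have "I - {a, b} = I - {b}" using 3 by auto
    then show ?thesis using r[OF assms(1) 3(2)] 3 by (simp add: mult_ac)
  next
    case 4
    have "I - {a, b} = I" using 4 by auto
    then show ?thesis using 4 by simp
  qed
qed

lemma prod_change_two_factors:
  fixes f f' :: "nat \<Rightarrow> real"
  assumes fin: "finite I" and eq: "\<And>i. i \<in> I \<Longrightarrow> i \<noteq> a \<Longrightarrow> i \<noteq> b \<Longrightarrow> f' i = f i"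
    and ca: "a \<in> I \<Longrightarrow> c * f' a = f a" and ca': "a \<notin> I \<Longrightarrow> c = 1"
    and eb: "b \<in> I \<Longrightarrow> f' b = e * f b" and eb': "b \<notin> I \<Longrightarrow> e = 1"
    and ab: "a \<in> I \<Longrightarrow> b \<in> I \<Longrightarrow> a \<noteq> b"
  shows "c * prod f' I = e * prod f I"
proof -
  have J: "prod f' (I - {a, b}) = prod f (I - {a, b})" using eq by (intro prod.cong) auto
  have A: "c * (if a \<in> I then f' a else 1) = (if a \<in> I then f a else 1)" using ca ca' by auto
  have B: "(if b \<in> I then f' b else 1) = e * (if b \<in> I then f b else 1)" using eb eb' by auto
  have S: "prod f' I = prod f' (I - {a, b}) * (if a \<in> I then f' a else 1) * (if b \<in> I then f' b else 1)"
    using prod_split_two[of I a b f'] fin ab by blast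
  have "c * prod f' I = prod f' (I - {a, b}) * (c * (if a \<in> I then f' a else 1)) * (if b \<in> I then f' b else 1)"
    unfolding S by algebra
  also have "\<dots> = e * (prod f (I - {a, b}) * (if a \<in> I then f a else 1) * (if b \<in> I then f b else 1))"
    unfolding J A B by (simp add: mult_ac)
  also have "\<dots> = e * prod f I" using prod_split_two[of I a b f] fin ab by simp
  finally show ?thesis .
qed

definition Qfun_prefactor :: "real \<Rightarrow> int list \<Rightarrow> real" where
  "Qfun_prefactor q lam = (\<Prod>i<length lam - 1. qpinf q (q powi (lam!i - lam!(i+1) + 1)))"

lemma qpinf_powi_shift:
  assumes "0 < q" "q < 1"
  shows "qpinf q (q powi d) = (1 - q powi d) * qpinf q (q powi (d + 1))"
  using qpinf_shift[of q "q powi d"] assms by (simp add: power_int_add_1)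

lemma Qfun_prefactor_lower:
  assumes q: "0 < q" "q < 1" and l: "l \<in> {1..length lam}"
  shows "gap_factor_prev q 1 (nth lam) l * Qfun_prefactor q (lam[l-1 := lam!(l-1) - 1])
       = gap_factor_next q 0 (length lam) (nth lam) l * Qfun_prefactor q lam"
proof -
  define N where "N = length lam"
  define lam' where "lam' = lam[l-1 := lam!(l-1) - 1]"
  define f where "f = (\<lambda>i. qpinf q (q powi (lam!i - lam!(i+1) + 1)))"
  define f' where "f' = (\<lambda>i. qpinf q (q powi (lam'!i - lam'!(i+1) + 1)))"
  define a where "a = (if 2 \<le> l then l - 2 else N)"
  have lN: "l - 1 < N" using l by (auto simp: N_def)
  have nth': "lam'!i = (if i = l - 1 then lam!(l-1) - 1 else lam!i)" for i
    using lN by (auto simp: lam'_def N_def nth_list_update)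
  txt \<open>Only the factors for the gaps \<open>\<lambda>\<^sub>l\<^sub>-\<^sub>1 - \<lambda>\<^sub>l\<close> (index \<open>a\<close>, out of range if \<open>l = 1\<close>) and
    \<open>\<lambda>\<^sub>l - \<lambda>\<^sub>l\<^sub>+\<^sub>1\<close> (index \<open>l - 1\<close>) change.\<close>
  have "gap_factor_prev q 1 (nth lam) l * prod f' {..<N-1}
      = gap_factor_next q 0 N (nth lam) l * prod f {..<N-1}"
  proof (rule prod_change_two_factors)
    fix i assume "i \<in> {..<N-1}" "i \<noteq> a" "i \<noteq> l - 1"
    then have "i \<noteq> l - 1" "Suc i \<noteq> l - 1" using l by (auto simp: a_def split: if_splits)
    then show "f' i = f i" by (simp add: f'_def f_def nth')
  next
    assume "a \<in> {..<N-1}"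
    then have "a = l - 2" "Suc (l - 2) = l - 1" "l \<noteq> 1" by (auto simp: a_def split: if_splits)
    then show "gap_factor_prev q 1 (nth lam) l * f' a = f a"
      using qpinf_powi_shift[OF q, of "lam!(l-2) - lam!(l-1) + 1"]
      by (simp add: f_def f'_def nth' gap_factor_prev_def algebra_simps)
  next
    assume "a \<notin> {..<N-1}"
    then have "l = 1" using l lN by (auto simp: a_def N_def split: if_splits)
    then show "gap_factor_prev q 1 (nth lam) l = 1" by (simp add: gap_factor_prev_def)
  next
    assume "l - 1 \<in> {..<N-1}"
    then have "l < N" "Suc (l - 1) = l" using l by auto
    then show "f' (l - 1) = gap_factor_next q 0 N (nth lam) l * f (l - 1)"
      using qpinf_powi_shift[OF q, of "lam!(l-1) - lam!l"]
      by (simp add: f_def f'_def nth' gap_factor_next_def algebra_simps)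
  next
    assume "l - 1 \<notin> {..<N-1}"
    then have "l = N" using l lN by (auto simp: N_def)
    then show "gap_factor_next q 0 N (nth lam) l = 1" by (simp add: gap_factor_next_def)
  qed (auto simp: a_def split: if_splits)
  then show ?thesis unfolding Qfun_prefactor_def f_def f'_def lam'_def N_def by simp
qed

text \<open>The integrand of \<open>Q\<^sub>\<lambda>\<close> in the coordinates \<open>z\<^sub>j = e\<^bsup>i\<theta>\<^sub>j\<^esup>\<close>, without the factor \<open>e\<^bsup>t \<Sigma> z\<^sub>j\<^esup>\<close> of \<open>\<Pi>(z;\<alpha>,t)\<close>.\<close>
definition Q_kernel :: "real \<Rightarrow> int list \<Rightarrow> (nat \<Rightarrow> real) \<Rightarrow> nat \<Rightarrow> (nat \<Rightarrow> real) \<Rightarrow> complex" where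
  "Q_kernel q lam alpha N th = Pfun q lam (\<lambda>j. 1 / torus_point th j)
     * qpinf_inverse_prod q N alpha (torus_point th) * mq q N (torus_point th)"

definition torus_sum :: "nat \<Rightarrow> (nat \<Rightarrow> real) \<Rightarrow> complex" where
  "torus_sum N th = (\<Sum>j<N. torus_point th j)"

definition Q_integral :: "real \<Rightarrow> int list \<Rightarrow> (nat \<Rightarrow> real) \<Rightarrow> nat \<Rightarrow> real \<Rightarrow> complex" where
  "Q_integral q lam alpha N s =
     (\<integral>th. Q_kernel q lam alpha N th * exp (torus_sum N th * of_real s) \<partial>torus_measure N)"

lemma Qfun_eq_Q_integral:
  assumes "is_sig lam" "length lam = N"
  shows "Qfun q lam alpha s = of_real (Qfun_prefactor q lam) * (\<i> ^ N * Q_integral q lam alpha N s)"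
proof -
  have "Pfun q lam (\<lambda>j. 1 / exp (\<i> * of_real (th j))) * PiF q N (\<lambda>j. exp (\<i> * of_real (th j))) alpha s
        * mq q N (\<lambda>j. exp (\<i> * of_real (th j)))
      = Q_kernel q lam alpha N th * exp (torus_sum N th * of_real s)" for th
    unfolding Q_kernel_def torus_sum_def PiF_eq torus_point_def by (simp add: mult_ac)
  then show ?thesis
    using assms unfolding Qfun_def torus_int_def Q_integral_def torus_measure_def Qfun_prefactor_def
    by simp
qed

lemma borel_measurable_Q_kernel:
  assumes q: "0 < q" "q < 1" and len: "length lam = N"
  shows "Q_kernel q lam alpha N \<in> borel_measurable (torus_measure N)"
proof -
  have "\<bar>q\<bar> < 1" using q by simp
  then show ?thesis
    unfolding Q_kernel_def qpinf_inverse_prod_def mq_def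
    by (intro borel_measurable_times borel_measurable_Pfun borel_measurable_prod borel_measurable_inverse
          borel_measurable_qpinf borel_measurable_divide borel_measurable_const measurable_torus_point)
       (auto simp: len)
qed

lemma Q_kernel_bounded:
  assumes q: "0 < q" "q < 1" and al: "\<forall>i<N. 0 \<le> alpha i \<and> alpha i < 1"
  shows "\<exists>B. \<forall>th. norm (Q_kernel q lam alpha N th) \<le> B"
proof -
  obtain BP where BP: "\<And>x::nat \<Rightarrow> complex. (\<forall>j. norm (x j) = 1) \<Longrightarrow> norm (Pfun q lam x) \<le> BP"
    using Pfun_bounded_on_unimodular[of q lam] by auto
  define BI where "BI = (\<Prod>i<N. \<Prod>j<N. 1 / qpinf q (alpha i))"
  define BM where "BM = norm (1 / ((2 * of_real pi * \<i>) ^ N * of_nat (fact N) :: complex))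
     * (\<Prod>i<N. \<Prod>j\<in>{i+1..<N}. exp (1 / (1 - q)) * exp (1 / (1 - q)))"
  have "norm (Q_kernel q lam alpha N th) \<le> BP * BI * BM" for th
  proof -
    have bp: "norm (Pfun q lam (\<lambda>j. 1 / torus_point th j)) \<le> BP" by (rule BP) (simp add: norm_divide)
    have bi: "norm (qpinf_inverse_prod q N alpha (torus_point th)) \<le> BI"
      unfolding BI_def by (rule norm_qpinf_inverse_prod_le[OF q al]) simp
    have bm: "norm (mq q N (torus_point th)) \<le> BM"
      unfolding BM_def by (rule norm_mq_le[OF q]) simp
    show ?thesis
      unfolding Q_kernel_def norm_mult
      using bp bi bm by (intro mult_mono mult_nonneg_nonneg) (auto intro: order_trans[OF norm_ge_zero])
  qed
  then show ?thesis by blast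
qed

lemma borel_measurable_torus_sum: "torus_sum N \<in> borel_measurable (torus_measure N)"
  unfolding torus_sum_def by (intro borel_measurable_sum measurable_torus_point) auto

lemma norm_torus_sum_le: "norm (torus_sum N th) \<le> real N"
  unfolding torus_sum_def using norm_sum[of "torus_point th" "{..<N}"] by simp

lemma Q_kernel_pieri:
  assumes q: "0 < q" "q < 1" and sig: "is_sig lam" and len: "length lam = N"
  shows "Q_kernel q lam alpha N th * torus_sum N th
    = (\<Sum>l=1..N. of_real (gap_factor_next q 0 N (nth lam) l) * Q_kernel q (lam[l-1 := lam!(l-1) - 1]) alpha N th)"
proof -
  have "torus_sum N th * Pfun q lam (\<lambda>j. 1 / torus_point th j)
      = (\<Sum>l=1..N. of_real (gap_factor_next q 0 N (nth lam) l)
                  * Pfun q (lam[l-1 := lam!(l-1) - 1]) (\<lambda>j. 1 / torus_point th j))"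
    using Pfun_pieri[OF q _ sig len, of "\<lambda>j. 1 / torus_point th j"] by (simp add: torus_sum_def)
  note pieri = this
  have "Q_kernel q lam alpha N th * torus_sum N th
      = torus_sum N th * Pfun q lam (\<lambda>j. 1 / torus_point th j)
        * (qpinf_inverse_prod q N alpha (torus_point th) * mq q N (torus_point th))"
    by (simp add: Q_kernel_def mult_ac)
  also have "\<dots> = (\<Sum>l=1..N. of_real (gap_factor_next q 0 N (nth lam) l)
                  * Pfun q (lam[l-1 := lam!(l-1) - 1]) (\<lambda>j. 1 / torus_point th j))
        * (qpinf_inverse_prod q N alpha (torus_point th) * mq q N (torus_point th))"
    by (simp only: pieri)
  also have "\<dots> = (\<Sum>l=1..N. of_real (gap_factor_next q 0 N (nth lam) l) * Q_kernel q (lam[l-1 := lam!(l-1) - 1]) alpha N th)"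
    by (simp add: Q_kernel_def sum_distrib_right mult.assoc)
  finally show ?thesis .
qed

lemma Q_integral_has_vector_derivative:
  assumes q: "0 < q" "q < 1" and sig: "is_sig lam" and len: "length lam = N"
    and al: "\<forall>i<N. 0 \<le> alpha i \<and> alpha i < 1"
  shows "((\<lambda>s. Q_integral q lam alpha N s) has_vector_derivative
      (\<Sum>l=1..N. of_real (gap_factor_next q 0 N (nth lam) l) * Q_integral q (lam[l-1 := lam!(l-1) - 1]) alpha N t)) (at t)"
proof -
  let ?K = "\<lambda>lam'. Q_kernel q lam' alpha N" and ?E = "\<lambda>th. exp (torus_sum N th * of_real t)"
  have integrable: "integrable (torus_measure N) (\<lambda>th. ?K lam' th * ?E th)" if "length lam' = N" for lam'
  proof -
    obtain B where "\<And>th. norm (?K lam' th) \<le> B" using Q_kernel_bounded[OF q al] by blast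
    then show ?thesis
      by (rule integrable_bounded_mult_exp[OF finite_measure_torus borel_measurable_Q_kernel[OF q that]
               borel_measurable_torus_sum _ norm_torus_sum_le])
  qed
  obtain B where B: "\<And>th. norm (?K lam th) \<le> B" using Q_kernel_bounded[OF q al] by blast
  have "((\<lambda>s. Q_integral q lam alpha N s) has_vector_derivative
      (\<integral>th. ?K lam th * torus_sum N th * ?E th \<partial>torus_measure N)) (at t)"
    unfolding Q_integral_def
    by (rule has_vector_derivative_integral_exp[OF finite_measure_torus borel_measurable_Q_kernel[OF q len]
          borel_measurable_torus_sum B norm_torus_sum_le])
  also have "(\<integral>th. ?K lam th * torus_sum N th * ?E th \<partial>torus_measure N)
      = (\<integral>th. (\<Sum>l=1..N. of_real (gap_factor_next q 0 N (nth lam) l) * (?K (lam[l-1 := lam!(l-1) - 1]) th * ?E th))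
           \<partial>torus_measure N)"
    unfolding Q_kernel_pieri[OF q sig len] sum_distrib_right by (simp add: mult.assoc)
  also have "\<dots> = (\<Sum>l=1..N. of_real (gap_factor_next q 0 N (nth lam) l) * Q_integral q (lam[l-1 := lam!(l-1) - 1]) alpha N t)"
    using integrable len by (subst Bochner_Integration.integral_sum) (auto simp: Q_integral_def)
  finally show ?thesis .
qed

lemma Qfun_has_vector_derivative:
  assumes q: "0 < q" "q < 1" and sig: "is_sig lam" and al: "\<forall>i<length lam. 0 \<le> alpha i \<and> alpha i < 1"
  shows "((\<lambda>s. Qfun q lam alpha s) has_vector_derivative
      (\<Sum>l=1..length lam. of_real (gap_factor_prev q 1 (nth lam) l) * Qfun q (lam[l-1 := lam!(l-1) - 1]) alpha t)) (at t)"
proof -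
  define N where "N = length lam"
  have "((\<lambda>s. Qfun q lam alpha s) has_vector_derivative
      of_real (Qfun_prefactor q lam) * (\<i> ^ N * (\<Sum>l=1..N. of_real (gap_factor_next q 0 N (nth lam) l)
        * Q_integral q (lam[l-1 := lam!(l-1) - 1]) alpha N t))) (at t)"
    unfolding Qfun_eq_Q_integral[OF sig N_def[symmetric]]
    using Q_integral_has_vector_derivative[OF q sig N_def[symmetric]] al
    by (auto simp: N_def intro!: has_vector_derivative_mult_right)
  also have "of_real (Qfun_prefactor q lam) * (\<i> ^ N * (\<Sum>l=1..N. of_real (gap_factor_next q 0 N (nth lam) l)
        * Q_integral q (lam[l-1 := lam!(l-1) - 1]) alpha N t))
      = (\<Sum>l=1..N. of_real (gap_factor_prev q 1 (nth lam) l) * Qfun q (lam[l-1 := lam!(l-1) - 1]) alpha t)"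
    unfolding sum_distrib_left
  proof (rule sum.cong[OF refl])
    fix l assume l: "l \<in> {1..N}"
    let ?lam' = "lam[l-1 := lam!(l-1) - 1]"
    have prefactor: "gap_factor_prev q 1 (nth lam) l * Qfun_prefactor q ?lam'
        = gap_factor_next q 0 N (nth lam) l * Qfun_prefactor q lam"
      using Qfun_prefactor_lower[OF q, of l lam] l by (simp add: N_def)
    show "of_real (Qfun_prefactor q lam) * (\<i> ^ N * (of_real (gap_factor_next q 0 N (nth lam) l)
        * Q_integral q ?lam' alpha N t))
      = of_real (gap_factor_prev q 1 (nth lam) l) * Qfun q ?lam' alpha t"
    proof (cases "is_sig ?lam'")
      case True
      then show ?thesis
        using prefactor Qfun_eq_Q_integral[OF True, of N q alpha t]
        by (simp add: N_def mult_ac flip: of_real_mult)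
    next
      case False
      then have "gap_factor_next q 0 N (nth lam) l = 0" using is_sig_lower[OF sig, of l q] l by (auto simp: N_def)
      then show ?thesis using False by (simp add: Qfun_def)
    qed
  qed
  finally show ?thesis by (simp add: N_def)
qed

theorem mainTheorem8:
  fixes q :: real
  assumes "0 < q" and "q < 1"
  shows
  "(\<forall>k lam mu (a::real). 1 \<le> k \<longrightarrow> length lam = k \<longrightarrow> is_sig lam \<longrightarrow>
      length mu = k - 1 \<longrightarrow> is_sig mu \<longrightarrow> 0 < a \<longrightarrow>
      (\<Sum>l=1..k. (if l = 1 then 1 else 1 - q powi (lam!(l-2) - lam!(l-1)))
                   * Pskew q (lam[l-1 := lam!(l-1) + 1]) mu a)
      = a * Pskew q lam mu a
        + (\<Sum>l=1..k-1. (if l = 1 then 1 else 1 - q powi (mu!(l-2) - mu!(l-1) + 1))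
                   * Pskew q lam (mu[l-1 := mu!(l-1) - 1]) a))
   \<and>
   (\<forall>lam alpha (t::real). is_sig lam \<longrightarrow>
      (\<forall>i<length lam. 0 \<le> alpha i \<and> alpha i < 1) \<longrightarrow> 0 < t \<longrightarrow>
      ((\<lambda>s. Qfun q lam alpha s) has_vector_derivative
         (\<Sum>l=1..length lam.
            of_real (if l = 1 then 1 else 1 - q powi (lam!(l-2) - lam!(l-1) + 1))
            * Qfun q (lam[l-1 := lam!(l-1) - 1]) alpha t)) (at t))"
proof (intro conjI allI impI)
  fix k lam mu and a :: real
  assume "1 \<le> k" "length lam = k" "is_sig lam" "length mu = k - 1" "is_sig mu" "0 < a"
  then show "(\<Sum>l=1..k. (if l = 1 then 1 else 1 - q powi (lam!(l-2) - lam!(l-1)))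
                   * Pskew q (lam[l-1 := lam!(l-1) + 1]) mu a)
      = a * Pskew q lam mu a
        + (\<Sum>l=1..k-1. (if l = 1 then 1 else 1 - q powi (mu!(l-2) - mu!(l-1) + 1))
                   * Pskew q lam (mu[l-1 := mu!(l-1) - 1]) a)"
    using Pskew_raise_identity[OF assms, of k lam mu a] by (simp add: gap_factor_prev_def cong: if_cong)
next
  fix lam :: "int list" and alpha :: "nat \<Rightarrow> real" and t :: real
  assume "is_sig lam" "\<forall>i<length lam. 0 \<le> alpha i \<and> alpha i < 1"
  then show "((\<lambda>s. Qfun q lam alpha s) has_vector_derivative
         (\<Sum>l=1..length lam.
            of_real (if l = 1 then 1 else 1 - q powi (lam!(l-2) - lam!(l-1) + 1))
            * Qfun q (lam[l-1 := lam!(l-1) - 1]) alpha t)) (at t)"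
    using Qfun_has_vector_derivative[OF assms] by (simp add: gap_factor_prev_def)
qed

end
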